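(* Let $\mathcal{H}$ be a complex Hilbert space, let $n$ be a positive integer, and let $A_i,B_i\in\mathcal{B}(\mathcal{H})$ for all $i=1,2,\ldots,n$. Then $$r\left(\sum_{i=1}^n A_iB_i\right)\leq w\left(\begin{bmatrix} w(B_1A_1)&a_{12}&\ldots&a_{1n}\\ 0&w(B_2A_2)&\ldots&a_{2n}\\ \vdots&\vdots& &\vdots\\ 0&0&\ldots&w(B_nA_n)\end{bmatrix}\right)\leq\max_{1\leq i\leq n}\left\{w(B_iA_i)+\frac12\sum_{j=i+1}^n a_{ij}+\frac12\sum_{j=1}^{i-1}a_{ji}\right\},$$ where the matrix in the middle is the upper triangular $n\times n$ complex matrix with diagonal entries $w(B_iA_i)$ and, for $i<j$, $(i,j)$ entry $a_{ij}$, with $$a_{ij}=\left\||B_iA_j|+|A_i^*B_j^*|\right\|^{1/2}\left\||B_jA_i|+|A_j^*B_i^*|\right\|^{1/2}.$$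
   Context: $\mathcal{B}(\mathcal{H})$ is the algebra of bounded linear operators on $\mathcal{H}$ with operator norm $\|\cdot\|$. For $A\in\mathcal{B}(\mathcal{H})$, $|A|=(A^*A)^{1/2}$, $r(A)$ is the spectral radius of $A$, and the numerical radius is $w(A)=\sup\{|\langle Ax,x\rangle|: x\in\mathcal{H},\ \|x\|=1\}$. An $n\times n$ complex matrix is viewed as an operator on $\mathbb{C}^n$ with its standard inner product, and its numerical radius is taken there. Empty sums are zero. *)

theory Defs
  imports
    "HOL-Analysis.Inner_Product"
    "HOL-Analysis.Operator_Norm"
    "HOL-Library.Complex_Order"
    "Jordan_Normal_Form.Matrix"
begin

class complex_vector = real_vector +
  fixes scaleC :: "complex \<Rightarrow> 'a \<Rightarrow> 'a"
  assumes scaleC_add_right: "scaleC c (x + y) = scaleC c x + scaleC c y"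
    and scaleC_add_left: "scaleC (c + d) x = scaleC c x + scaleC d x"
    and scaleC_scaleC: "scaleC c (scaleC d x) = scaleC (c * d) x"
    and scaleC_one: "scaleC 1 x = x"
    and scaleR_scaleC: "scaleR r x = scaleC (complex_of_real r) x"

text \<open>The complex inner product is linear in its first argument. Positive definiteness and
  the norm are inherited from \<^class>\<open>real_inner\<close>, because
  \<^term>\<open>inner x x\<close> is the (real) number \<^term>\<open>cinner x x\<close>.\<close>

class complex_inner = complex_vector + real_inner +
  fixes cinner :: "'a \<Rightarrow> 'a \<Rightarrow> complex"
  assumes cinner_commute: "cinner x y = cnj (cinner y x)"
    and cinner_add_left: "cinner (x + y) z = cinner x z + cinner y z"
    and cinner_scaleC_left: "cinner (scaleC c x) y = c * cinner x y"
    and inner_eq_Re_cinner: "inner x y = Re (cinner x y)"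

class complex_hilbert = complex_inner + complete_space

instantiation complex :: complex_hilbert
begin

definition scaleC_complex :: "complex \<Rightarrow> complex \<Rightarrow> complex"
  where "scaleC_complex c x = c * x"

definition cinner_complex :: "complex \<Rightarrow> complex \<Rightarrow> complex"
  where "cinner_complex x y = x * cnj y"

instance
  by standard
    (auto simp: scaleC_complex_def cinner_complex_def inner_complex_def scaleR_conv_of_real
      algebra_simps)

end

definition bounded_clinear :: "('a::complex_hilbert \<Rightarrow> 'a) \<Rightarrow> bool"
  where "bounded_clinear A \<longleftrightarrow>
    bounded_linear A \<and> (\<forall>c x. A (scaleC c x) = scaleC c (A x))"

definition cadjoint :: "('a::complex_hilbert \<Rightarrow> 'a) \<Rightarrow> ('a \<Rightarrow> 'a)"
  where "cadjoint A =
    (THE S. bounded_clinear S \<and> (\<forall>x y. cinner (A x) y = cinner x (S y)))"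

text \<open>Here \<open>0 \<le> z\<close> on the complex numbers means that \<open>z\<close> is real and nonnegative.\<close>

definition positive_op :: "('a::complex_hilbert \<Rightarrow> 'a) \<Rightarrow> bool"
  where "positive_op P \<longleftrightarrow> bounded_clinear P \<and> (\<forall>x. 0 \<le> cinner (P x) x)"

definition op_abs :: "('a::complex_hilbert \<Rightarrow> 'a) \<Rightarrow> ('a \<Rightarrow> 'a)"
  where "op_abs A = (THE P. positive_op P \<and> P \<circ> P = cadjoint A \<circ> A)"

definition op_spectrum :: "('a::complex_hilbert \<Rightarrow> 'a) \<Rightarrow> complex set"
  where "op_spectrum A =
    {z. \<not> (\<exists>S. bounded_clinear S \<and>
      S \<circ> (\<lambda>x. A x - scaleC z x) = id \<and> (\<lambda>x. A x - scaleC z x) \<circ> S = id)}"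

text \<open>The suprema are taken in \<open>[0, \<infinity>)\<close>. Inserting \<open>0\<close> matters only for the zero space, where
  the spectrum and the unit sphere are empty and both radii are \<open>0\<close>.\<close>

definition op_spectral_radius :: "('a::complex_hilbert \<Rightarrow> 'a) \<Rightarrow> real"
  where "op_spectral_radius A = Sup (insert 0 {cmod z | z. z \<in> op_spectrum A})"

definition numerical_radius :: "('a::complex_hilbert \<Rightarrow> 'a) \<Rightarrow> real"
  where "numerical_radius A = Sup (insert 0 {cmod (cinner (A x) x) | x. norm x = 1})"

text \<open>For a square matrix with at least one row, acting on column vectors with the standard
  inner product.\<close>

definition mat_numerical_radius :: "complex mat \<Rightarrow> real"
  where "mat_numerical_radius M =
    Sup {cmod ((M *\<^sub>v x) \<bullet>c x) | x. x \<in> carrier_vec (dim_col M) \<and> x \<bullet>c x = 1}"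

end

theory Submission
  imports Defs "HOL-Analysis.Elementary_Metric_Spaces"
begin

text \<open>The operator \<open>\<Sum>\<^sub>i A\<^sub>i B\<^sub>i\<close> has the same nonzero spectrum as the operator matrix \<open>[B\<^sub>i A\<^sub>j]\<close>,
  whose spectral radius is at most its numerical radius. For a unit vector \<open>(x\<^sub>i)\<close>, the diagonal
  of \<open>\<Sum>\<^sub>i\<^sub>j \<langle>B\<^sub>i A\<^sub>j x\<^sub>j, x\<^sub>i\<rangle>\<close> is controlled by \<open>w(B\<^sub>i A\<^sub>i)\<close>, and the two entries of index
  \<open>{i, j}\<close> together by \<open>a\<^sub>i\<^sub>j \<parallel>x\<^sub>i\<parallel> \<parallel>x\<^sub>j\<parallel>\<close>: this is the mixed Schwarz inequality
  \<open>|\<langle>S x, y\<rangle>|\<^sup>2 \<le> \<langle>|S| x, x\<rangle> \<langle>|S\<^sup>*| y, y\<rangle>\<close> for \<open>S = B\<^sub>i A\<^sub>j\<close> and for \<open>T = B\<^sub>j A\<^sub>i\<close>, followed by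
  Cauchy-Schwarz in the plane. What remains is the quadratic form of the triangular matrix at
  the vector \<open>(\<parallel>x\<^sub>i\<parallel>)\<close>; the second bound follows from \<open>2 t\<^sub>i t\<^sub>j \<le> t\<^sub>i\<^sup>2 + t\<^sub>j\<^sup>2\<close>.

  Moduli come from the iteration \<open>Y \<mapsto> (X + Y\<^sup>2) / 2\<close> with \<open>X = 1 - P / K\<close>, whose limit \<open>Y\<close>
  satisfies \<open>(1 - Y)\<^sup>2 = P / K\<close>. The increments are dominated by those of the scalar iteration
  at \<open>X = 1\<close>, an increasing sequence bounded by \<open>1\<close>.\<close>

section \<open>Adjoints and coercive operators\<close>

text \<open>Near \<open>t = 0\<close> the linear term dominates, so a nonzero \<open>a\<close> would
  give a negative value at some \<open>t\<close> of the opposite sign. This extracts the first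
  variation at a minimiser.\<close>

lemma psd_linear_coeff_eq_0:
  fixes a b :: real
  assumes "\<And>t. 0 \<le> t * a + t\<^sup>2 * b"
  shows "a = 0"
proof (rule ccontr)
  assume "a \<noteq> 0"
  define c where "c = \<bar>b\<bar> + 1"
  have c: "c > 0" "b < c" unfolding c_def by auto
  \<comment> \<open>Since \<open>b < c\<close>, the value at \<open>t = - a / c\<close> turns out
    strictly negative.\<close>
  have "0 \<le> (- a / c) * a + (- a / c)\<^sup>2 * b" by (rule assms)
  also have "\<dots> = (a\<^sup>2 / c) * (b / c - 1)"
    using c by (simp add: field_simps power2_eq_square)
  finally have "0 \<le> (a\<^sup>2 / c) * (b / c - 1)" .
  moreover have "a\<^sup>2 / c > 0" using c \<open>a \<noteq> 0\<close> by simp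
  ultimately have "0 \<le> b / c - 1" by (simp only: zero_le_mult_iff) linarith
  then show False using c by (simp add: field_simps)
qed

text \<open>Variational argument: the minimiser \<open>u\<close> of
  \<open>F x = (norm x)^2 / 2 - f x\<close> represents \<open>f\<close>, because the derivative of
  \<open>F\<close> at \<open>u\<close> in direction \<open>v\<close> is
  \<open>inner u v - f v\<close>.\<close>

lemma riesz_representation:
  fixes f :: "'a::{real_inner,complete_space} \<Rightarrow> real"
  assumes "bounded_linear f"
  obtains u where "\<And>v. f v = inner u v"
proof -
  interpret f: bounded_linear f by fact
  obtain K where K: "\<And>x. norm (f x) \<le> norm x * K" using f.bounded by blast
  define F where "F x = (norm x)\<^sup>2 / 2 - f x" for x
  \<comment> \<open>Parallelogram law; the contributions of \<open>f\<close> cancel by linearity. It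
    makes every minimising sequence Cauchy.\<close>
  have par: "(norm (x - y))\<^sup>2 = 4 * (F x + F y - 2 * F ((x + y) /\<^sub>R 2))" for x y
    by (simp add: F_def power2_norm_eq_inner f.add f.scaleR inner_add inner_diff
        inner_commute field_simps)
  have lower: "- (K\<^sup>2 / 2) \<le> F x" for x
  proof -
    have "f x \<le> norm x * K" using K[of x] by simp
    moreover have "0 \<le> (norm x - K)\<^sup>2" by simp
    ultimately show ?thesis by (simp add: F_def power2_eq_square algebra_simps)
  qed
  define m where "m = Inf (range F)"
  have bdd: "bdd_below (range F)" using lower by (auto intro!: bdd_belowI[of _ "- (K\<^sup>2 / 2)"])
  have m_le: "m \<le> F x" for x unfolding m_def using bdd by (auto intro: cInf_lower)
  define r where "r k = inverse (real (Suc k))" for k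
  have "\<exists>x. F x < m + r k" for k
    using cInf_lessD[of "range F" "m + r k"] by (auto simp: m_def r_def)
  then obtain X where X: "\<And>k. F (X k) < m + r k" by metis
  have dist: "(norm (X i - X j))\<^sup>2 \<le> 4 * (r i + r j)" for i j
  proof -
    have "F (X i) + F (X j) - 2 * F ((X i + X j) /\<^sub>R 2) \<le> r i + r j"
      using X[of i] X[of j] m_le[of "(X i + X j) /\<^sub>R 2"] by simp
    then show ?thesis unfolding par by (rule mult_left_mono) simp
  qed
  have "Cauchy X"
  proof (rule metric_CauchyI)
    fix e :: real assume "e > 0"
    obtain N where N: "r N < e\<^sup>2 / 8"
      using \<open>e > 0\<close> reals_Archimedean[of "e\<^sup>2 / 8"] by (auto simp: r_def)
    have "dist (X i) (X j) < e" if "i \<ge> N" "j \<ge> N" for i j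
    proof -
      have "r i \<le> r N" "r j \<le> r N"
        using that by (auto simp: r_def intro!: le_imp_inverse_le)
      then have "4 * (r i + r j) \<le> 8 * r N" by simp
      also have "\<dots> < e\<^sup>2" using N by simp
      finally have "(norm (X i - X j))\<^sup>2 < e\<^sup>2" using dist[of i j] by simp
      then show ?thesis using \<open>e > 0\<close> by (simp add: dist_norm power_less_imp_less_base)
    qed
    then show "\<exists>M. \<forall>i\<ge>M. \<forall>j\<ge>M. dist (X i) (X j) < e" by blast
  qed
  then obtain u where u: "X \<longlonglongrightarrow> u" using Cauchy_convergent convergent_def by blast
  have "(\<lambda>k. F (X k)) \<longlonglongrightarrow> F u"
    unfolding F_def by (intro tendsto_intros f.tendsto u) simp
  moreover have "(\<lambda>k. m + r k) \<longlonglongrightarrow> m + 0"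
    unfolding r_def by (intro tendsto_intros LIMSEQ_inverse_real_of_nat)
  ultimately have "F u \<le> m + 0"
    by (rule LIMSEQ_le) (use X in \<open>auto intro!: exI[of _ 0] less_imp_le\<close>)
  then have min: "F u \<le> F x" for x using m_le[of x] by simp
  have "inner u v - f v = 0" for v
  proof (rule psd_linear_coeff_eq_0)
    fix t :: real
    have "F (u + t *\<^sub>R v) - F u = t * (inner u v - f v) + t\<^sup>2 * ((norm v)\<^sup>2 / 2)"
      unfolding F_def power2_norm_eq_inner
      by (simp add: f.add f.scaleR inner_add inner_commute field_simps power2_eq_square)
    then show "0 \<le> t * (inner u v - f v) + t\<^sup>2 * ((norm v)\<^sup>2 / 2)"
      using min[of "u + t *\<^sub>R v"] by simp
  qed
  then show ?thesis using that[of u] by simp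
qed

lemma inner_eq_ext:
  fixes x y :: "'a::real_inner"
  assumes "\<And>z. inner z x = inner z y"
  shows "x = y"
proof -
  have "inner (x - y) (x - y) = 0" using assms[of "x - y"] by (simp only: inner_diff_right)
  then show ?thesis by simp
qed

text \<open>Test the adjoint identity at \<open>x = S y\<close> and cancel one factor
  \<open>norm (S y)\<close>.\<close>

lemma adjoint_norm_le:
  fixes A S :: "'a::real_inner \<Rightarrow> 'a"
  assumes adj: "\<And>x y. inner (A x) y = inner x (S y)"
    and bound: "\<And>x. norm (A x) \<le> c * norm x"
  shows "norm (S y) \<le> c * norm y"
proof (cases "S y = 0")
  case True
  have "0 \<le> c * norm y" using bound[of y] norm_ge_zero order_trans by blast
  then show ?thesis using True by simp
next
  case False
  have "norm (S y) * norm (S y) = inner (A (S y)) y"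
    by (simp add: adj flip: power2_norm_eq_inner power2_eq_square)
  also have "\<dots> \<le> norm (A (S y)) * norm y" by (rule norm_cauchy_schwarz)
  also have "\<dots> \<le> c * norm (S y) * norm y" by (intro mult_right_mono bound) auto
  finally have "norm (S y) * norm (S y) \<le> norm (S y) * (c * norm y)" by (simp add: mult_ac)
  then show ?thesis using False by (simp add: mult_le_cancel_left_pos)
qed

lemma adjoint_exists:
  fixes A :: "'a::{real_inner,complete_space} \<Rightarrow> 'a"
  assumes "bounded_linear A"
  obtains S where "bounded_linear S" "\<And>x y. inner (A x) y = inner x (S y)"
proof -
  interpret A: bounded_linear A by fact
  have "\<exists>s. \<forall>x. inner (A x) y = inner x s" for y
  proof -
    have "bounded_linear (\<lambda>x. inner (A x) y)"
      by (rule bounded_linear_compose[OF bounded_linear_inner_left assms])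
    then obtain s where "\<And>x. inner (A x) y = inner s x" using riesz_representation by blast
    then show ?thesis by (auto simp: inner_commute)
  qed
  then obtain S where S: "\<And>x y. inner (A x) y = inner x (S y)" by metis
  obtain c where c: "\<And>x. norm (A x) \<le> norm x * c" using A.bounded by blast
  have "bounded_linear S"
  proof (rule bounded_linear_intro)
    show "S (x + y) = S x + S y" for x y
      by (rule inner_eq_ext) (simp add: inner_add_right flip: S)
    show "S (r *\<^sub>R x) = r *\<^sub>R S x" for r x
      by (rule inner_eq_ext) (simp flip: S)
    show "norm (S x) \<le> norm x * c" for x
      using adjoint_norm_le[OF S, of c x] c by (simp add: mult.commute)
  qed
  then show ?thesis using S that by blast
qed

text \<open>A solution of \<open>P x = y\<close> is a fixed point of
  \<open>x - t *\<^sub>R P x + t *\<^sub>R y\<close>, which is a contraction for a suitable step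
  size \<open>t\<close>.\<close>

lemma lax_milgram_surj:
  fixes P :: "'a::{real_inner,complete_space} \<Rightarrow> 'a"
  assumes "bounded_linear P" and "e > 0"
    and coercive: "\<And>x. e * (norm x)\<^sup>2 \<le> inner (P x) x"
  shows "surj P"
proof -
  interpret P: bounded_linear P by fact
  obtain K where K: "K > 0" "\<And>x. norm (P x) \<le> norm x * K" using P.pos_bounded by blast
  \<comment> \<open>This \<open>t\<close> minimises \<open>1 - 2 * t * e + t^2 * K^2\<close>, and
    \<open>q\<close> is the minimum.\<close>
  define t where "t = e / K\<^sup>2"
  define q where "q = 1 - e\<^sup>2 / K\<^sup>2"
  have t: "t > 0" using \<open>e > 0\<close> K by (simp add: t_def)
  have contr: "(norm (x - t *\<^sub>R P x))\<^sup>2 \<le> q * (norm x)\<^sup>2" for x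
  proof -
    have "(norm (x - t *\<^sub>R P x))\<^sup>2 = (norm x)\<^sup>2 - 2 * t * inner (P x) x + t\<^sup>2 * (norm (P x))\<^sup>2"
      unfolding power2_norm_eq_inner
      by (simp add: inner_diff inner_commute[of x "P x"] power2_eq_square algebra_simps)
    also have "\<dots> \<le> (norm x)\<^sup>2 - 2 * t * (e * (norm x)\<^sup>2) + t\<^sup>2 * (norm x * K)\<^sup>2"
      using t coercive[of x] K(2)[of x] by (intro add_mono diff_mono mult_left_mono power_mono) auto
    also have "\<dots> = q * (norm x)\<^sup>2"
      using K by (simp add: t_def q_def field_simps power2_eq_square)
    finally show ?thesis .
  qed
  show ?thesis
  \<comment> \<open>In the zero space nothing relates \<open>e\<close> to \<open>K\<close>, so
    \<open>q\<close> might be negative there; a nonzero vector forces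
    \<open>0 \<le> q\<close>.\<close>
  proof (cases "\<exists>x::'a. x \<noteq> 0")
    case False
    show ?thesis
    proof (rule surjI)
      fix y
      have "P y = 0" "y = 0" using False by blast+
      then show "P y = y" by (rule trans[OF _ sym])
    qed
  next
    case True
    then obtain x0 :: 'a where "x0 \<noteq> 0" by blast
    then have q0: "0 \<le> q"
      using order_trans[OF zero_le_power2 contr[of x0]] by (simp add: zero_le_mult_iff)
    have q1: "q < 1" using \<open>e > 0\<close> K by (simp add: q_def)
    show ?thesis
      unfolding surj_def
    proof
      fix y
      define G where "G x = x - t *\<^sub>R P x + t *\<^sub>R y" for x
      have "dist (G x) (G z) \<le> sqrt q * dist x z" for x z
      proof -
        have "G x - G z = (x - z) - t *\<^sub>R P (x - z)"
          by (simp add: G_def P.diff scaleR_diff_right)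
        then have "norm (G x - G z) = sqrt ((norm ((x - z) - t *\<^sub>R P (x - z)))\<^sup>2)" by simp
        also have "\<dots> \<le> sqrt (q * (norm (x - z))\<^sup>2)"
          using contr[of "x - z"] by (rule real_sqrt_le_mono)
        finally show ?thesis by (simp add: dist_norm real_sqrt_mult)
      qed
      then have "\<exists>!x. G x = x"
        using q0 q1 by (intro banach_fix_type[of "sqrt q"]) auto
      then obtain x where "G x = x" by blast
      then show "\<exists>x. y = P x" using t by (auto simp: G_def)
    qed
  qed
qed

section \<open>Square roots of positive operators\<close>

text \<open>The form at \<open>x + t *\<^sub>R y\<close> is a quadratic polynomial in
  \<open>t\<close> that is nowhere negative.\<close>

lemma psd_cauchy_schwarz:
  fixes P :: "'a::real_inner \<Rightarrow> 'a"
  assumes "linear P"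
    and sym: "\<And>x y. inner (P x) y = inner x (P y)"
    and pos: "\<And>x. 0 \<le> inner (P x) x"
  shows "(inner (P x) y)\<^sup>2 \<le> inner (P x) x * inner (P y) y"
proof -
  interpret linear P by fact
  have quad: "0 \<le> inner (P x) x + 2 * t * inner (P x) y + t\<^sup>2 * inner (P y) y" for t
  proof -
    have "inner (P y) x = inner (P x) y" using sym[of y x] by (simp add: inner_commute)
    then have "inner (P (x + t *\<^sub>R y)) (x + t *\<^sub>R y)
        = inner (P x) x + 2 * t * inner (P x) y + t\<^sup>2 * inner (P y) y"
      by (simp add: add scale inner_add power2_eq_square algebra_simps)
    then show ?thesis using pos by metis
  qed
  show ?thesis
  proof (cases "inner (P y) y = 0")
    case True
    have "inner (P x) y = 0"
    proof (rule ccontr)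
      assume "inner (P x) y \<noteq> 0"
      \<comment> \<open>With no quadratic term, this \<open>t\<close> makes the polynomial equal to
        -1.\<close>
      then show False
        using quad[of "- (inner (P x) x + 1) / (2 * inner (P x) y)"] True
        by (simp add: field_simps)
    qed
    then show ?thesis by (simp add: True)
  next
    case False
    then have "inner (P y) y > 0" using pos[of y] by simp
    \<comment> \<open>This \<open>t\<close> is the minimiser of the quadratic.\<close>
    then show ?thesis
      using quad[of "- inner (P x) y / inner (P y) y"] by (simp add: field_simps power2_eq_square)
  qed
qed

text \<open>Cauchy-Schwarz for the form, taken at \<open>y = P x\<close>, bounds the fourth power of
  \<open>norm (P x)\<close> by 0.\<close>

lemma psd_eq_0:
  fixes P :: "'a::real_inner \<Rightarrow> 'a"
  assumes "linear P"
    and sym: "\<And>x y. inner (P x) y = inner x (P y)"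
    and pos: "\<And>x. 0 \<le> inner (P x) x"
    and "inner (P x) x = 0"
  shows "P x = 0"
  using psd_cauchy_schwarz[OF assms(1-3), of x "P x"] assms(4) by simp

section \<open>Convergence of the square root iteration\<close>

primrec sqrt_iter :: "('a::real_vector \<Rightarrow> 'a) \<Rightarrow> nat \<Rightarrow> 'a \<Rightarrow> 'a" where
  "sqrt_iter X 0 = (\<lambda>v. 0)"
| "sqrt_iter X (Suc k) = (\<lambda>v. (X v + sqrt_iter X k (sqrt_iter X k v)) /\<^sub>R 2)"

primrec sqrt_iter_bound :: "nat \<Rightarrow> real" where
  "sqrt_iter_bound 0 = 0"
| "sqrt_iter_bound (Suc k) = (1 + (sqrt_iter_bound k)\<^sup>2) / 2"

lemma sqrt_iter_bound_range: "0 \<le> sqrt_iter_bound k \<and> sqrt_iter_bound k \<le> 1"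
proof (induction k)
  case (Suc k)
  then have "(sqrt_iter_bound k)\<^sup>2 \<le> 1\<^sup>2" by (intro power_mono) auto
  then show ?case by simp
qed simp

lemma incseq_sqrt_iter_bound: "incseq sqrt_iter_bound"
proof (rule incseq_SucI)
  fix k
  \<comment> \<open>Half of this square is the increment of the scalar iteration.\<close>
  have "0 \<le> (sqrt_iter_bound k - 1)\<^sup>2" by simp
  then show "sqrt_iter_bound k \<le> sqrt_iter_bound (Suc k)"
    by (simp add: power2_eq_square algebra_simps)
qed

lemma linear_sqrt_iter:
  assumes "linear X"
  shows "linear (sqrt_iter X k)"
proof (induction k)
  case 0
  show ?case by (simp add: module_hom_zero linear_iff)
next
  case (Suc k)
  then show ?case using assms by (simp add: linear_iff algebra_simps)
qed

text \<open>Each iterate is a polynomial in \<open>X\<close>, so an intertwining relation passes to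
  it. Two different operators \<open>X\<close> and \<open>X'\<close> are allowed in order to relate
  the roots of \<open>S' \<circ> S\<close> and \<open>S \<circ> S'\<close>.\<close>

lemma sqrt_iter_intertwine:
  assumes "linear T" "\<And>v. T (X v) = X' (T v)"
  shows "T (sqrt_iter X k v) = sqrt_iter X' k (T v)"
  by (induction k arbitrary: v) (use assms in \<open>simp_all add: linear_0 linear_add linear_cmul\<close>)

lemma sqrt_iter_sym:
  fixes X :: "'a::real_inner \<Rightarrow> 'a"
  assumes "\<And>x y. inner (X x) y = inner x (X y)"
  shows "inner (sqrt_iter X k x) y = inner x (sqrt_iter X k y)"
  by (induction k arbitrary: x y) (simp_all add: assms inner_add)

context
  fixes X :: "'a::{real_normed_vector,complete_space} \<Rightarrow> 'a"
  assumes lin: "linear X" and contr: "\<And>v. norm (X v) \<le> norm v"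
begin

lemma norm_sqrt_iter_le: "norm (sqrt_iter X k v) \<le> sqrt_iter_bound k * norm v"
proof (induction k arbitrary: v)
  case (Suc k)
  have "norm (sqrt_iter X k (sqrt_iter X k v)) \<le> sqrt_iter_bound k * norm (sqrt_iter X k v)"
    by (rule Suc)
  also have "\<dots> \<le> sqrt_iter_bound k * (sqrt_iter_bound k * norm v)"
    using Suc sqrt_iter_bound_range by (intro mult_left_mono) auto
  finally have "norm (X v + sqrt_iter X k (sqrt_iter X k v))
      \<le> norm v + sqrt_iter_bound k * (sqrt_iter_bound k * norm v)"
    using contr[of v] by (intro norm_triangle_le) simp
  then show ?case
    unfolding sqrt_iter.simps sqrt_iter_bound.simps norm_scaleR
    by (simp add: power2_eq_square algebra_simps)
qed simp

lemma norm_sqrt_iter_le_norm: "norm (sqrt_iter X k v) \<le> norm v"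
  using norm_sqrt_iter_le[of k v] sqrt_iter_bound_range[of k]
    mult_right_mono[of "sqrt_iter_bound k" 1 "norm v"] by auto

text \<open>With \<open>Y\<close> and \<open>Z\<close> consecutive iterates,
  \<open>Z Z - Y Y = (Z - Y) Z + Y (Z - Y)\<close>. Bounding each factor by its scalar counterpart
  reproduces the increment of the scalar iteration.\<close>

lemma norm_sqrt_iter_Suc_diff_le:
  "norm (sqrt_iter X (Suc k) v - sqrt_iter X k v)
    \<le> (sqrt_iter_bound (Suc k) - sqrt_iter_bound k) * norm v"
proof (induction k arbitrary: v)
  case 0
  show ?case using contr[of v] by simp
next
  case (Suc k)
  let ?Y = "sqrt_iter X" and ?y = sqrt_iter_bound
  interpret Y: linear "?Y k" by (rule linear_sqrt_iter[OF lin])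
  have d: "0 \<le> ?y (Suc k) - ?y k" using incseq_sqrt_iter_bound by (simp add: incseq_SucD del: sqrt_iter_bound.simps)
  have "?Y (Suc (Suc k)) v - ?Y (Suc k) v
      = ((?Y (Suc k) (?Y (Suc k) v) - ?Y k (?Y (Suc k) v)) + ?Y k (?Y (Suc k) v - ?Y k v)) /\<^sub>R 2"
  proof -
    have "?Y (Suc (Suc k)) v = (X v + ?Y (Suc k) (?Y (Suc k) v)) /\<^sub>R 2"
      "?Y (Suc k) v = (X v + ?Y k (?Y k v)) /\<^sub>R 2" by simp_all
    then have "?Y (Suc (Suc k)) v - ?Y (Suc k) v
        = (?Y (Suc k) (?Y (Suc k) v) - ?Y k (?Y k v)) /\<^sub>R 2"
      by (simp only: scaleR_diff_right[symmetric] add_diff_cancel_left)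
    then show ?thesis by (simp only: Y.diff diff_add_cancel add_diff_eq)
  qed
  then have "norm (?Y (Suc (Suc k)) v - ?Y (Suc k) v)
      \<le> (norm (?Y (Suc k) (?Y (Suc k) v) - ?Y k (?Y (Suc k) v))
      + norm (?Y k (?Y (Suc k) v - ?Y k v))) / 2"
    using norm_triangle_ineq[of "?Y (Suc k) (?Y (Suc k) v) - ?Y k (?Y (Suc k) v)"
        "?Y k (?Y (Suc k) v - ?Y k v)"] by (simp only: norm_scaleR) simp
  also have "\<dots> \<le> ((?y (Suc k) - ?y k) * (?y (Suc k) * norm v) + ?y k * ((?y (Suc k) - ?y k) * norm v)) / 2"
  proof (intro divide_right_mono add_mono)
    show "norm (?Y (Suc k) (?Y (Suc k) v) - ?Y k (?Y (Suc k) v))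
        \<le> (?y (Suc k) - ?y k) * (?y (Suc k) * norm v)"
      by (rule order_trans[OF Suc mult_left_mono[OF norm_sqrt_iter_le d]])
    show "norm (?Y k (?Y (Suc k) v - ?Y k v)) \<le> ?y k * ((?y (Suc k) - ?y k) * norm v)"
      using sqrt_iter_bound_range
      by (intro order_trans[OF norm_sqrt_iter_le mult_left_mono[OF Suc]]) simp
  qed simp
  also have "\<dots> = (?y (Suc (Suc k)) - ?y (Suc k)) * norm v"
  proof -
    have "?y (Suc (Suc k)) - ?y (Suc k) = ((?y (Suc k))\<^sup>2 - (?y k)\<^sup>2) / 2"
      using sqrt_iter_bound.simps(2)[of k] sqrt_iter_bound.simps(2)[of "Suc k"] by argo
    then show ?thesis by (simp only: power2_eq_square) (simp add: algebra_simps del: sqrt_iter_bound.simps)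
  qed
  finally show ?case .
qed

lemma norm_sqrt_iter_diff_le:
  assumes "k \<le> m"
  shows "norm (sqrt_iter X m v - sqrt_iter X k v)
    \<le> (sqrt_iter_bound m - sqrt_iter_bound k) * norm v"
  using assms
proof (induction m rule: dec_induct)
  case (step m)
  have "norm (sqrt_iter X (Suc m) v - sqrt_iter X k v)
      \<le> norm (sqrt_iter X (Suc m) v - sqrt_iter X m v) + norm (sqrt_iter X m v - sqrt_iter X k v)"
    using norm_triangle_ineq[of "sqrt_iter X (Suc m) v - sqrt_iter X m v"
        "sqrt_iter X m v - sqrt_iter X k v"] by (simp del: sqrt_iter.simps)
  also have "\<dots> \<le> (sqrt_iter_bound (Suc m) - sqrt_iter_bound m) * norm v
      + (sqrt_iter_bound m - sqrt_iter_bound k) * norm v"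
    by (intro add_mono norm_sqrt_iter_Suc_diff_le step)
  also have "\<dots> = (sqrt_iter_bound (Suc m) - sqrt_iter_bound k) * norm v"
    by (simp add: algebra_simps del: sqrt_iter_bound.simps)
  finally show ?case .
qed simp

text \<open>The scalar iterates increase and are bounded, hence Cauchy; the operator increments at a
  fixed vector inherit this.\<close>

lemma convergent_sqrt_iter: "convergent (\<lambda>k. sqrt_iter X k v)"
proof -
  have "bdd_above (range sqrt_iter_bound)"
    using sqrt_iter_bound_range by (auto intro!: bdd_aboveI[of _ 1])
  then have "convergent sqrt_iter_bound"
    using LIMSEQ_incseq_SUP[OF _ incseq_sqrt_iter_bound] convergentI by blast
  then have "convergent (\<lambda>k. sqrt_iter_bound k * norm v)"
    by (intro convergent_mult convergent_const)
  then have cau: "Cauchy (\<lambda>k. sqrt_iter_bound k * norm v)" by (rule convergent_Cauchy)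
  have "Cauchy (\<lambda>k. sqrt_iter X k v)"
  proof (rule metric_CauchyI)
    fix e :: real assume "e > 0"
    then obtain N where N: "\<And>m k. m \<ge> N \<Longrightarrow> k \<ge> N \<Longrightarrow>
        dist (sqrt_iter_bound m * norm v) (sqrt_iter_bound k * norm v) < e"
      using metric_CauchyD[OF cau] by metis
    have le: "dist (sqrt_iter X m v) (sqrt_iter X k v) < e" if "N \<le> k" "k \<le> m" for m k
    proof -
      have "dist (sqrt_iter X m v) (sqrt_iter X k v)
          \<le> sqrt_iter_bound m * norm v - sqrt_iter_bound k * norm v"
        using norm_sqrt_iter_diff_le[OF \<open>k \<le> m\<close>, of v] by (simp add: dist_norm algebra_simps)
      also have "\<dots> < e" using N[of m k] that by (simp add: dist_real_def)
      finally show ?thesis .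
    qed
    have "dist (sqrt_iter X m v) (sqrt_iter X k v) < e" if "N \<le> m" "N \<le> k" for m k
      using le[of k m] le[of m k] that by (cases "k \<le> m") (auto simp: dist_commute)
    then show "\<exists>M. \<forall>m\<ge>M. \<forall>n\<ge>M. dist (sqrt_iter X m v) (sqrt_iter X n v) < e" by blast
  qed
  then show ?thesis by (rule Cauchy_convergent)
qed

lemma sqrt_iter_tendsto: "(\<lambda>k. sqrt_iter X k v) \<longlonglongrightarrow> lim (\<lambda>k. sqrt_iter X k v)"
  by (rule convergent_LIMSEQ_iff[THEN iffD1, OF convergent_sqrt_iter])

lemma linear_sqrt_lim: "linear (\<lambda>v. lim (\<lambda>k. sqrt_iter X k v))"
proof (rule linearI)
  note lin_k = linear_sqrt_iter[OF lin]
  show "lim (\<lambda>k. sqrt_iter X k (u + v)) = lim (\<lambda>k. sqrt_iter X k u) + lim (\<lambda>k. sqrt_iter X k v)" for u v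
    unfolding linear_add[OF lin_k] by (rule limI, rule tendsto_add; rule sqrt_iter_tendsto)
  show "lim (\<lambda>k. sqrt_iter X k (r *\<^sub>R v)) = r *\<^sub>R lim (\<lambda>k. sqrt_iter X k v)" for r v
    unfolding linear_cmul[OF lin_k] by (rule limI, rule tendsto_scaleR[OF tendsto_const], rule sqrt_iter_tendsto)
qed

lemma norm_sqrt_lim_le: "norm (lim (\<lambda>k. sqrt_iter X k v)) \<le> norm v"
  by (rule LIMSEQ_le_const2[OF tendsto_norm[OF sqrt_iter_tendsto]])
    (use norm_sqrt_iter_le_norm in blast)

text \<open>The recursion in the limit. As convergence is only pointwise, the square is handled by
  writing \<open>Y\<^sub>k (Y\<^sub>k v)\<close> as
  \<open>Y\<^sub>k (Y\<^sub>k v - L v) + Y\<^sub>k (L v)\<close>; the first summand vanishes in the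
  limit because all iterates are contractions.\<close>

lemma sqrt_lim_eq:
  "2 *\<^sub>R lim (\<lambda>k. sqrt_iter X k v)
    = X v + lim (\<lambda>k. sqrt_iter X k (lim (\<lambda>k. sqrt_iter X k v)))"
proof -
  let ?L = "\<lambda>v. lim (\<lambda>k. sqrt_iter X k v)"
  have "(\<lambda>k. sqrt_iter X k (sqrt_iter X k v - ?L v)) \<longlonglongrightarrow> 0"
  proof (rule tendsto_0_le)
    show "(\<lambda>k. sqrt_iter X k v - ?L v) \<longlonglongrightarrow> 0"
      using tendsto_diff[OF sqrt_iter_tendsto[of v] tendsto_const[of "?L v"]] by simp
    show "\<forall>\<^sub>F k in sequentially. norm (sqrt_iter X k (sqrt_iter X k v - ?L v))
        \<le> norm (sqrt_iter X k v - ?L v) * 1"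
      by (simp add: norm_sqrt_iter_le_norm)
  qed
  from tendsto_add[OF this sqrt_iter_tendsto[of "?L v"]]
  have "(\<lambda>k. sqrt_iter X k (sqrt_iter X k v)) \<longlonglongrightarrow> ?L (?L v)"
    by (simp add: linear_diff[OF linear_sqrt_iter[OF lin]])
  then have "(\<lambda>k. sqrt_iter X (Suc k) v) \<longlonglongrightarrow> (X v + ?L (?L v)) /\<^sub>R 2"
    unfolding sqrt_iter.simps by (intro tendsto_intros)
  moreover have "(\<lambda>k. sqrt_iter X (Suc k) v) \<longlonglongrightarrow> ?L v"
    by (rule LIMSEQ_Suc[OF sqrt_iter_tendsto])
  ultimately have "?L v = (X v + ?L (?L v)) /\<^sub>R 2" using LIMSEQ_unique by blast
  then have "2 *\<^sub>R ?L v = 2 *\<^sub>R ((X v + ?L (?L v)) /\<^sub>R 2)" by (rule arg_cong)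
  then show ?thesis by simp
qed

end

section \<open>The positive square root and its uniqueness\<close>

definition sqrt_op :: "real \<Rightarrow> ('a::{real_normed_vector,complete_space} \<Rightarrow> 'a) \<Rightarrow> 'a \<Rightarrow> 'a" where
  "sqrt_op K P v = sqrt K *\<^sub>R (v - lim (\<lambda>k. sqrt_iter (\<lambda>v. v - P v /\<^sub>R K) k v))"

text \<open>Continuity of \<open>T\<close> carries the relation from the iterates to their limit. It
  serves three times: \<open>T = Q\<close> for uniqueness of the root, \<open>T = S\<close> for the
  mixed Schwarz inequality, and \<open>T = scaleC c\<close> for complex linearity.\<close>

lemma sqrt_op_intertwine:
  assumes "bounded_linear T" "linear P" "linear P'"
    and "\<And>v. norm (v - P v /\<^sub>R K) \<le> norm v" "\<And>v. norm (v - P' v /\<^sub>R K) \<le> norm v"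
    and "\<And>v. T (P v) = P' (T v)"
  shows "T (sqrt_op K P v) = sqrt_op K P' (T v)"
proof -
  interpret T: bounded_linear T by fact
  have lin: "linear (\<lambda>v. v - P v /\<^sub>R K)" "linear (\<lambda>v. v - P' v /\<^sub>R K)"
    using assms(2,3) by (auto simp: linear_iff algebra_simps)
  have "T (sqrt_iter (\<lambda>v. v - P v /\<^sub>R K) k v) = sqrt_iter (\<lambda>v. v - P' v /\<^sub>R K) k (T v)" for k
    by (rule sqrt_iter_intertwine) (simp_all add: T.linear T.diff T.scaleR assms(6))
  moreover have "(\<lambda>k. T (sqrt_iter (\<lambda>v. v - P v /\<^sub>R K) k v))
      \<longlonglongrightarrow> T (lim (\<lambda>k. sqrt_iter (\<lambda>v. v - P v /\<^sub>R K) k v))"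
    by (rule T.tendsto[OF sqrt_iter_tendsto[OF lin(1) assms(4)]])
  ultimately have "lim (\<lambda>k. sqrt_iter (\<lambda>v. v - P' v /\<^sub>R K) k (T v))
      = T (lim (\<lambda>k. sqrt_iter (\<lambda>v. v - P v /\<^sub>R K) k v))"
    by (intro limI) simp
  then show ?thesis by (simp add: sqrt_op_def T.scaleR T.diff)
qed

context
  fixes P :: "'a::{real_inner,complete_space} \<Rightarrow> 'a" and K :: real
  assumes lin: "linear P" and K: "0 < K"
    and contr: "\<And>v. norm (v - P v /\<^sub>R K) \<le> norm v"
begin

private lemma linear_compl: "linear (\<lambda>v. v - P v /\<^sub>R K)"
  using lin by (auto simp: linear_iff algebra_simps)

lemma linear_sqrt_op: "linear (sqrt_op K P)"
  using linear_sqrt_lim[OF linear_compl contr] by (auto simp: sqrt_op_def linear_iff algebra_simps)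

lemma bounded_linear_sqrt_op: "bounded_linear (sqrt_op K P)"
proof (rule bounded_linear_intro)
  show "sqrt_op K P (x + y) = sqrt_op K P x + sqrt_op K P y"
    "sqrt_op K P (r *\<^sub>R x) = r *\<^sub>R sqrt_op K P x" for x y r
    using linear_sqrt_op by (simp_all add: linear_iff)
  show "norm (sqrt_op K P x) \<le> norm x * (sqrt K * 2)" for x
  proof -
    have "norm (x - lim (\<lambda>k. sqrt_iter (\<lambda>v. v - P v /\<^sub>R K) k x)) \<le> norm x + norm x"
      using norm_sqrt_lim_le[OF linear_compl contr, of x] norm_triangle_ineq4 order_trans
        add_left_mono by blast
    then have "sqrt K * norm (x - lim (\<lambda>k. sqrt_iter (\<lambda>v. v - P v /\<^sub>R K) k x))
        \<le> sqrt K * (norm x + norm x)"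
      using K by (intro mult_left_mono) auto
    then show ?thesis using K by (simp add: sqrt_op_def mult_ac)
  qed
qed

text \<open>The limit of the iteration is a contraction, so its quadratic form is at most
  \<open>inner v v\<close>.\<close>

lemma sqrt_op_pos: "0 \<le> inner (sqrt_op K P v) v"
proof -
  let ?L = "lim (\<lambda>k. sqrt_iter (\<lambda>v. v - P v /\<^sub>R K) k v)"
  have "inner ?L v \<le> norm ?L * norm v" by (rule norm_cauchy_schwarz)
  also have "\<dots> \<le> norm v * norm v"
    by (intro mult_right_mono norm_sqrt_lim_le[OF linear_compl contr]) simp
  also have "\<dots> = inner v v" by (simp add: power2_norm_eq_inner flip: power2_eq_square)
  finally show ?thesis using K by (simp add: sqrt_op_def inner_diff_left)
qed

text \<open>With limit \<open>L\<close> and \<open>X = 1 - P / K\<close>, the equation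
  \<open>2 L = X + L^2\<close> turns \<open>1 - 2 L + L^2\<close> into
  \<open>1 - X = P / K\<close>.\<close>

lemma sqrt_op_square: "sqrt_op K P (sqrt_op K P v) = P v"
proof -
  let ?L = "\<lambda>v. lim (\<lambda>k. sqrt_iter (\<lambda>v. v - P v /\<^sub>R K) k v)"
  interpret L: linear ?L by (rule linear_sqrt_lim[OF linear_compl contr])
  have "sqrt_op K P (sqrt_op K P v) = K *\<^sub>R ((v + ?L (?L v)) - 2 *\<^sub>R ?L v)"
    using K by (simp add: sqrt_op_def L.scale L.diff scaleR_2 algebra_simps del: scaleR_diff_right
        flip: scaleR_diff_right)
  also have "\<dots> = K *\<^sub>R (P v /\<^sub>R K)"
    unfolding sqrt_lim_eq[OF linear_compl contr, of v] by simp
  finally show ?thesis using K by simp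
qed

lemma sqrt_op_sym:
  assumes "\<And>x y. inner (P x) y = inner x (P y)"
  shows "inner (sqrt_op K P x) y = inner x (sqrt_op K P y)"
proof -
  let ?Y = "sqrt_iter (\<lambda>v. v - P v /\<^sub>R K)"
  have "inner (?Y k x) y = inner x (?Y k y)" for k
    by (rule sqrt_iter_sym) (simp add: inner_diff assms)
  moreover have "(\<lambda>k. inner (?Y k x) y) \<longlonglongrightarrow> inner (lim (\<lambda>k. ?Y k x)) y"
    "(\<lambda>k. inner x (?Y k y)) \<longlonglongrightarrow> inner x (lim (\<lambda>k. ?Y k y))"
    by (intro tendsto_inner tendsto_const sqrt_iter_tendsto[OF linear_compl contr])+
  ultimately have "inner (lim (\<lambda>k. ?Y k x)) y = inner x (lim (\<lambda>k. ?Y k y))"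
    using LIMSEQ_unique by simp
  then show ?thesis by (simp add: sqrt_op_def inner_diff)
qed

end

text \<open>The constructed root commutes with every \<open>Q\<close> with \<open>Q\<^sup>2 = P\<close>, so \<open>R + Q\<close> annihilates
  the range of \<open>R - Q\<close>; as \<open>R\<close> and \<open>Q\<close> are positive, each of them does.\<close>

lemma sqrt_op_unique:
  fixes P Q :: "'a::{real_inner,complete_space} \<Rightarrow> 'a"
  assumes K: "0 < K" and contr: "\<And>v. norm (v - P v /\<^sub>R K) \<le> norm v"
    and P_sym: "\<And>x y. inner (P x) y = inner x (P y)"
    and Q: "bounded_linear Q"
    and Q_sym: "\<And>x y. inner (Q x) y = inner x (Q y)"
    and Q_pos: "\<And>x. 0 \<le> inner (Q x) x"
    and Q_square: "\<And>x. Q (Q x) = P x"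
  shows "Q = sqrt_op K P"
proof
  fix x
  let ?R = "sqrt_op K P"
  interpret Q: bounded_linear Q by fact
  have P_lin: "linear P"
    unfolding Q_square[symmetric] linear_iff by (simp add: Q.add Q.scaleR)
  note R_lin = linear_sqrt_op[OF P_lin K contr]
  note R_sym = sqrt_op_sym[OF P_lin K contr P_sym]
  note R_pos = sqrt_op_pos[OF P_lin K contr]
  note R_square = sqrt_op_square[OF P_lin K contr]
  have comm: "Q (?R v) = ?R (Q v)" for v
    by (rule sqrt_op_intertwine[OF Q P_lin P_lin contr contr]) (simp flip: Q_square)
  define y where "y = ?R x - Q x"
  have "?R y + Q y = 0"
    by (simp add: y_def linear_diff[OF R_lin] Q.diff R_square Q_square comm)
  then have "inner (?R y) y + inner (Q y) y = 0" by (simp flip: inner_add_left)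
  then have "inner (?R y) y = 0" "inner (Q y) y = 0"
    using R_pos[of y] Q_pos[of y] by linarith+
  then have "?R y = 0" "Q y = 0"
    using psd_eq_0[OF R_lin R_sym R_pos] psd_eq_0[OF Q.linear Q_sym Q_pos] by blast+
  \<comment> \<open>Symmetry moves \<open>R - Q\<close> from \<open>x\<close> onto \<open>y\<close>,
    where it vanishes.\<close>
  moreover have "inner y y = inner (?R y - Q y) x"
    by (simp add: y_def inner_diff_right inner_diff_left R_sym Q_sym)
  ultimately have "y = 0" by simp
  then show "Q x = ?R x" by (simp add: y_def)
qed

section \<open>Adjoints, moduli and the mixed Schwarz inequality\<close>

text \<open>Makes \<open>S' \<circ> S\<close> with \<open>K = c^2\<close> admissible for the
  iteration. On expanding the square, the cross term contributes
  \<open>-2 * (norm (S v))^2 / c^2\<close>, which outweighs the last term.\<close>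

lemma adjoint_norm_sq_le:
  fixes S S' :: "'a::real_inner \<Rightarrow> 'a"
  assumes adj: "\<And>x y. inner (S x) y = inner x (S' y)"
    and "0 < c" and bound: "\<And>x. norm (S x) \<le> c * norm x"
  shows "norm (v - S' (S v) /\<^sub>R c\<^sup>2) \<le> norm v"
proof -
  have "norm (S' (S v)) \<le> c * norm (S v)" by (rule adjoint_norm_le[OF adj bound])
  then have "(norm (S' (S v)))\<^sup>2 \<le> (c * norm (S v))\<^sup>2" by (intro power_mono) auto
  then have "(norm (S' (S v)))\<^sup>2 / (c\<^sup>2)\<^sup>2 \<le> (c * norm (S v))\<^sup>2 / (c\<^sup>2)\<^sup>2"
    by (intro divide_right_mono) auto
  also have "\<dots> = (norm (S v))\<^sup>2 / c\<^sup>2"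
    using \<open>0 < c\<close> by (simp add: field_simps power2_eq_square)
  finally have le: "(norm (S' (S v)))\<^sup>2 / (c\<^sup>2)\<^sup>2 \<le> (norm (S v))\<^sup>2 / c\<^sup>2" .
  have "inner v (S' (S v)) = (norm (S v))\<^sup>2" by (simp add: power2_norm_eq_inner adj)
  then have "(norm (v - S' (S v) /\<^sub>R c\<^sup>2))\<^sup>2
      = (norm v)\<^sup>2 - 2 * ((norm (S v))\<^sup>2 / c\<^sup>2) + (norm (S' (S v)))\<^sup>2 / (c\<^sup>2)\<^sup>2"
    unfolding power2_norm_eq_inner
    by (simp add: inner_diff inner_commute[of "S' (S v)" v] divide_inverse power2_eq_square
        algebra_simps)
  also have "\<dots> \<le> (norm v)\<^sup>2" using le zero_le_power2[of "norm (S v)"]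
    by (smt (verit) divide_nonneg_nonneg zero_le_power2)
  finally show ?thesis by (rule power2_le_imp_le) simp
qed

text \<open>Write \<open>x = R u + e u\<close>. Since \<open>S R = L S\<close>, the form \<open>\<langle>S R u, y\<rangle>\<close> is \<open>\<langle>L S u, y\<rangle>\<close>, to which the
  Cauchy-Schwarz inequality for the positive operator \<open>L\<close> applies, and \<open>\<langle>L S u, S u\<rangle>\<close> is
  \<open>\<langle>R R u, R u\<rangle>\<close>. This avoids the polar decomposition.\<close>

lemma mixed_schwarz_real:
  fixes S S' :: "'a::{real_inner,complete_space} \<Rightarrow> 'a"
  assumes S: "bounded_linear S" and S': "bounded_linear S'"
    and adj: "\<And>x y. inner (S x) y = inner x (S' y)"
    and c: "0 < c" and bound: "\<And>x. norm (S x) \<le> c * norm x"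
  shows "inner (S x) y
    \<le> sqrt (inner (sqrt_op (c\<^sup>2) (S' \<circ> S) x) x * inner (sqrt_op (c\<^sup>2) (S \<circ> S') y) y)"
proof -
  interpret S: bounded_linear S by fact
  interpret S': bounded_linear S' by fact
  have adj': "inner (S' x) y = inner x (S y)" for x y
    using adj[of y x] by (simp add: inner_commute)
  have bound': "norm (S' x) \<le> c * norm x" for x
    by (rule adjoint_norm_le[OF adj bound])
  have lin: "linear (S' \<circ> S)" "linear (S \<circ> S')"
    by (intro linear_compose S.linear S'.linear)+
  have contr: "norm (v - (S' \<circ> S) v /\<^sub>R c\<^sup>2) \<le> norm v" "norm (v - (S \<circ> S') v /\<^sub>R c\<^sup>2) \<le> norm v" for v
    using adjoint_norm_sq_le[OF adj c bound] adjoint_norm_sq_le[OF adj' c bound'] by simp_all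
  have sym: "inner ((S' \<circ> S) x) y = inner x ((S' \<circ> S) y)"
    "inner ((S \<circ> S') x) y = inner x ((S \<circ> S') y)" for x y
    by (simp_all add: adj adj')
  have c2: "0 < c\<^sup>2" using c by simp
  define R where "R = sqrt_op (c\<^sup>2) (S' \<circ> S)"
  define L where "L = sqrt_op (c\<^sup>2) (S \<circ> S')"
  have R_bl: "bounded_linear R"
    unfolding R_def by (rule bounded_linear_sqrt_op[OF lin(1) c2 contr(1)])
  interpret R: bounded_linear R by fact
  have L_lin: "linear L" unfolding L_def by (rule linear_sqrt_op[OF lin(2) c2 contr(2)])
  have R_sym: "inner (R x) y = inner x (R y)" for x y
    unfolding R_def by (rule sqrt_op_sym[OF lin(1) c2 contr(1) sym(1)])
  have L_sym: "inner (L x) y = inner x (L y)" for x y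
    unfolding L_def by (rule sqrt_op_sym[OF lin(2) c2 contr(2) sym(2)])
  have R_pos: "0 \<le> inner (R x) x" for x
    unfolding R_def by (rule sqrt_op_pos[OF lin(1) c2 contr(1)])
  have L_pos: "0 \<le> inner (L x) x" for x
    unfolding L_def by (rule sqrt_op_pos[OF lin(2) c2 contr(2)])
  have R_square: "R (R v) = S' (S v)" for v
    using sqrt_op_square[OF lin(1) c2 contr(1)] by (simp add: R_def o_def)
  \<comment> \<open>\<open>S\<close> intertwines \<open>S' \<circ> S\<close> with
    \<open>S \<circ> S'\<close>, hence also their roots.\<close>
  have SR: "S (R v) = L (S v)" for v
    unfolding R_def L_def by (rule sqrt_op_intertwine[OF S lin contr]) simp
  have approx: "inner (S x) y \<le> sqrt (inner (R x) x * inner (L y) y) + e * (norm x * norm y)"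
    if e: "0 < e" for e
  proof -
    \<comment> \<open>\<open>R + e\<close> is coercive with constant \<open>e\<close>, so it is onto
      even when \<open>R\<close> is not.\<close>
    have "surj (\<lambda>u. R u + e *\<^sub>R u)"
    proof (rule lax_milgram_surj)
      show "bounded_linear (\<lambda>u. R u + e *\<^sub>R u)"
        by (intro bounded_linear_add R_bl bounded_linear_scaleR_right)
      show "0 < e" by fact
      show "e * (norm u)\<^sup>2 \<le> inner (R u + e *\<^sub>R u) u" for u
        using R_pos[of u] by (simp add: inner_add_left power2_norm_eq_inner)
    qed
    then obtain u where x: "x = R u + e *\<^sub>R u" unfolding surj_def by blast
    \<comment> \<open>Together with \<open>norm_R\<close> this bounds \<open>S u\<close> by
      \<open>norm x\<close>, uniformly in \<open>e\<close>, although \<open>u\<close> depends on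
      \<open>e\<close>.\<close>
    have norm_S: "norm (S u) = norm (R u)"
      by (simp add: norm_eq_sqrt_inner adj R_sym R_square)
    have "(norm x)\<^sup>2 = (norm (R u))\<^sup>2 + 2 * e * inner (R u) u + e\<^sup>2 * (norm u)\<^sup>2"
      unfolding x power2_norm_eq_inner
      by (simp add: inner_add inner_commute[of u "R u"] power2_eq_square algebra_simps)
    then have "(norm (R u))\<^sup>2 \<le> (norm x)\<^sup>2" using e R_pos[of u] by simp
    then have norm_R: "norm (R u) \<le> norm x" by (rule power2_le_imp_le) simp
    have "inner (R x) x
        = inner (R (R u)) (R u) + 2 * e * inner (R u) (R u) + e\<^sup>2 * inner (R u) u"
      unfolding x
      by (simp add: R.add R.scaleR inner_add R_sym[of "R u" u] power2_eq_square algebra_simps)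
    moreover have "inner (L (S u)) (S u) = inner (R (R u)) (R u)"
    proof -
      have "inner (L (S u)) (S u) = inner (R u) (S' (S u))" by (simp add: adj flip: SR)
      then show ?thesis by (simp add: inner_commute flip: R_square)
    qed
    ultimately have L_le: "inner (L (S u)) (S u) \<le> inner (R x) x" using e R_pos[of u] by simp
    have "(inner (L (S u)) y)\<^sup>2 \<le> inner (L (S u)) (S u) * inner (L y) y"
      by (rule psd_cauchy_schwarz[OF L_lin L_sym L_pos])
    also have "\<dots> \<le> inner (R x) x * inner (L y) y" by (rule mult_right_mono[OF L_le L_pos])
    finally have "inner (L (S u)) y \<le> sqrt (inner (R x) x * inner (L y) y)" by (rule real_le_rsqrt)
    moreover have "inner (S u) y \<le> norm x * norm y"
      using norm_cauchy_schwarz[of "S u" y] norm_S norm_R mult_right_mono[OF norm_R, of "norm y"] by simp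
    then have "e * inner (S u) y \<le> e * (norm x * norm y)" using e by simp
    moreover have "inner (S x) y = inner (L (S u)) y + e * inner (S u) y"
      by (simp add: x S.add S.scaleR SR inner_add_left)
    ultimately show ?thesis by simp
  qed
  have "inner (S x) y \<le> sqrt (inner (R x) x * inner (L y) y)"
  proof (rule field_le_epsilon)
    fix d :: real assume "0 < d"
    \<comment> \<open>The summand 1 keeps the denominator positive when \<open>x\<close> or
      \<open>y\<close> is zero.\<close>
    define e where "e = d / (norm x * norm y + 1)"
    have p: "0 < norm x * norm y + 1" by (simp add: add_nonneg_pos)
    then have "0 < e" using \<open>0 < d\<close> by (simp add: e_def)
    have "e * (norm x * norm y) \<le> e * (norm x * norm y + 1)" using \<open>0 < e\<close> by simp
    also have "\<dots> = d" using p by (simp add: e_def)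
    finally show "inner (S x) y \<le> sqrt (inner (R x) x * inner (L y) y) + d"
      using approx[OF \<open>0 < e\<close>] by simp
  qed
  then show ?thesis unfolding R_def L_def .
qed

section \<open>Complex inner products, adjoints and moduli\<close>

lemma cinner_add_right: "cinner x (y + z) = cinner x y + cinner x z"
  by (metis cinner_add_left cinner_commute complex_cnj_add)

lemma cinner_scaleC_right: "cinner x (scaleC c y) = cnj c * cinner x y"
  by (metis cinner_scaleC_left cinner_commute complex_cnj_mult)

lemma cinner_zero_left [simp]: "cinner 0 x = 0"
  using cinner_add_left[of 0 0 x] by simp

lemma cinner_diff_left: "cinner (x - y) z = cinner x z - cinner y z"
  using cinner_add_left[of "x - y" y z] by simp

lemma cinner_sum_left: "cinner (\<Sum>i\<in>I. f i) x = (\<Sum>i\<in>I. cinner (f i) x)"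
  by (induction I rule: infinite_finite_induct) (simp_all add: cinner_add_left)

lemma cinner_self: "cinner x x = complex_of_real ((norm x)\<^sup>2)"
proof (rule complex_eqI)
  show "Re (cinner x x) = Re (complex_of_real ((norm x)\<^sup>2))"
    by (simp add: power2_norm_eq_inner inner_eq_Re_cinner)
  have "Im (cinner x x) = Im (cnj (cinner x x))" by (simp flip: cinner_commute)
  then show "Im (cinner x x) = Im (complex_of_real ((norm x)\<^sup>2))" by simp
qed

text \<open>Recovers the complex inner product from the real one, so real identities lift to complex
  ones.\<close>

lemma Im_cinner: "Im (cinner x y) = inner x (scaleC \<i> y)"
  by (simp add: inner_eq_Re_cinner cinner_scaleC_right)

lemma inner_scaleC_right:
  fixes x y :: "'a::complex_inner"
  shows "inner x (scaleC c y) = inner (scaleC (cnj c) x) y"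
  by (simp add: inner_eq_Re_cinner cinner_scaleC_right cinner_scaleC_left)

lemma norm_scaleC:
  fixes x :: "'a::complex_inner"
  shows "norm (scaleC c x) = cmod c * norm x"
proof -
  have "(norm (scaleC c x))\<^sup>2 = (cmod c * norm x)\<^sup>2"
  proof -
    have "complex_of_real ((norm (scaleC c x))\<^sup>2) = c * cnj c * complex_of_real ((norm x)\<^sup>2)"
      unfolding cinner_self[symmetric] by (simp add: cinner_scaleC_left cinner_scaleC_right)
    also have "\<dots> = complex_of_real ((cmod c * norm x)\<^sup>2)"
      unfolding complex_norm_square[symmetric] by (simp add: power_mult_distrib)
    finally show ?thesis using of_real_eq_iff by blast
  qed
  then show ?thesis by (simp add: power2_eq_iff_nonneg)
qed

lemma bounded_linear_scaleC: "bounded_linear (scaleC c :: 'a::complex_inner \<Rightarrow> 'a)"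
  by (rule bounded_linear_intro[where K = "cmod c"])
    (simp_all add: scaleC_add_right scaleR_scaleC scaleC_scaleC norm_scaleC mult.commute)

text \<open>Rotating one argument turns the modulus into a real inner product, so real inequalities
  yield bounds on moduli. The zero case takes the phase 1 because \<open>sgn 0\<close> is not
  unimodular.\<close>

lemma cinner_phase:
  obtains c where "cmod c = 1" "inner (scaleC c x) y = cmod (cinner x y)"
proof (cases "cinner x y = 0")
  case True
  then show ?thesis using that[of 1] by (simp add: scaleC_one inner_eq_Re_cinner)
next
  case False
  let ?z = "cinner x y"
  have "cnj (sgn ?z) * ?z = complex_of_real (cmod ?z)"
    using False by (simp add: sgn_eq complex_norm_square[symmetric] mult.commute power2_eq_square)
  then have "inner (scaleC (cnj (sgn ?z)) x) y = cmod ?z"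
    by (simp add: inner_eq_Re_cinner cinner_scaleC_left)
  then show ?thesis using that[of "cnj (sgn ?z)"] False by (simp add: norm_sgn)
qed

lemma cmod_cinner_le: "cmod (cinner x y) \<le> norm x * norm y"
proof -
  obtain c where "cmod c = 1" "inner (scaleC c x) y = cmod (cinner x y)" by (rule cinner_phase)
  then show ?thesis using norm_cauchy_schwarz[of "scaleC c x" y] by (simp add: norm_scaleC)
qed

lemma bounded_clinear_imp_bounded_linear: "bounded_clinear A \<Longrightarrow> bounded_linear A"
  by (simp add: bounded_clinear_def)

lemma bounded_clinear_scaleC: "bounded_clinear A \<Longrightarrow> A (scaleC c x) = scaleC c (A x)"
  by (simp add: bounded_clinear_def)

lemma bounded_clinear_bound:
  assumes "bounded_clinear A"
  obtains c where "0 < c" "\<And>x. norm (A x) \<le> c * norm x"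
  using bounded_linear.pos_bounded[OF bounded_clinear_imp_bounded_linear[OF assms]]
  by (metis mult.commute)

lemma bounded_clinear_compose:
  "bounded_clinear A \<Longrightarrow> bounded_clinear B \<Longrightarrow> bounded_clinear (A \<circ> B)"
  unfolding bounded_clinear_def comp_def by (simp add: bounded_linear_compose)

lemma bounded_clinear_sum:
  "(\<And>i. i \<in> I \<Longrightarrow> bounded_clinear (A i)) \<Longrightarrow> bounded_clinear (\<lambda>x. \<Sum>i\<in>I. A i x)"
  unfolding bounded_clinear_def
  by (auto intro!: bounded_linear_sum simp: linear_sum[OF bounded_linear.linear[OF bounded_linear_scaleC]])

lemma bounded_clinear_diff_scaleC:
  assumes "bounded_clinear A"
  shows "bounded_clinear (\<lambda>x. A x - scaleC c x)"
  unfolding bounded_clinear_def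
proof (intro conjI allI)
  show "bounded_linear (\<lambda>x. A x - scaleC c x)"
    by (intro bounded_linear_sub bounded_linear_scaleC bounded_clinear_imp_bounded_linear assms)
  show "A (scaleC d x) - scaleC c (scaleC d x) = scaleC d (A x - scaleC c x)" for d x
    by (simp add: bounded_clinear_scaleC[OF assms] scaleC_scaleC mult.commute
        linear_diff[OF bounded_linear.linear[OF bounded_linear_scaleC]])
qed

text \<open>The real parts agree by assumption; the imaginary parts agree because \<open>S\<close>
  commutes with multiplication by the imaginary unit.\<close>

lemma cinner_adjointI:
  assumes "bounded_clinear A" "\<And>x y. inner (A x) y = inner x (S y)"
    and "\<And>c y. S (scaleC c y) = scaleC c (S y)"
  shows "cinner (A x) y = cinner x (S y)"
  by (rule complex_eqI) (simp_all add: Im_cinner assms flip: inner_eq_Re_cinner)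

lemma cadjointI:
  assumes "bounded_clinear S" "\<And>x y. cinner (A x) y = cinner x (S y)"
  shows "cadjoint A = S"
  unfolding cadjoint_def
proof (rule the_equality)
  show "bounded_clinear S \<and> (\<forall>x y. cinner (A x) y = cinner x (S y))" using assms by blast
  fix T assume "bounded_clinear T \<and> (\<forall>x y. cinner (A x) y = cinner x (T y))"
  then have "inner x (T y) = inner x (S y)" for x y
    using assms(2) by (metis inner_eq_Re_cinner)
  then have "T y = S y" for y by (rule inner_eq_ext)
  then show "T = S" by (rule ext)
qed

text \<open>The real adjoint from the Riesz representation is already complex linear, since
  \<open>A\<close> commutes with complex scalars.\<close>

lemma
  assumes A: "bounded_clinear A"
  shows bounded_clinear_cadjoint: "bounded_clinear (cadjoint A)"
    and cinner_cadjoint: "cinner (A x) y = cinner x (cadjoint A y)"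
proof -
  obtain S where S: "bounded_linear S" "\<And>x y. inner (A x) y = inner x (S y)"
    by (rule adjoint_exists[OF bounded_clinear_imp_bounded_linear[OF A]]) blast
  have scale: "S (scaleC c y) = scaleC c (S y)" for c y
    by (rule inner_eq_ext)
      (simp add: inner_scaleC_right bounded_clinear_scaleC[OF A] flip: S(2))
  have bc: "bounded_clinear S" using S(1) scale by (simp add: bounded_clinear_def)
  have eq: "cadjoint A = S" by (rule cadjointI[OF bc cinner_adjointI[OF A S(2) scale]])
  show "bounded_clinear (cadjoint A)" by (simp add: eq bc)
  show "cinner (A x) y = cinner x (cadjoint A y)"
    by (simp add: eq cinner_adjointI[OF A S(2) scale])
qed

lemma inner_cadjoint: "bounded_clinear A \<Longrightarrow> inner (A x) y = inner x (cadjoint A y)"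
  by (simp add: inner_eq_Re_cinner cinner_cadjoint)

lemma cinner_cadjoint_left: "bounded_clinear A \<Longrightarrow> cinner (cadjoint A x) y = cinner x (A y)"
  by (metis cinner_cadjoint cinner_commute)

lemma cadjoint_cadjoint: "bounded_clinear A \<Longrightarrow> cadjoint (cadjoint A) = A"
  by (rule cadjointI) (simp_all add: cinner_cadjoint_left)

lemma cadjoint_compose:
  assumes "bounded_clinear A" "bounded_clinear B"
  shows "cadjoint (A \<circ> B) = cadjoint B \<circ> cadjoint A"
  by (rule cadjointI)
    (simp_all add: assms bounded_clinear_compose bounded_clinear_cadjoint cinner_cadjoint)

text \<open>Real diagonal values suffice: expanding at \<open>u + v\<close> makes
  \<open>Im (cinner (P u) v)\<close> antisymmetric, and inserting the imaginary unit turns this into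
  symmetry of the real part.\<close>

lemma positive_op_sym:
  assumes "positive_op P"
  shows "inner (P x) y = inner x (P y)"
proof -
  have P: "bounded_clinear P" and real: "\<And>x. Im (cinner (P x) x) = 0"
    using assms by (auto simp: positive_op_def less_eq_complex_def)
  interpret bounded_linear P by (rule bounded_clinear_imp_bounded_linear[OF P])
  have anti: "Im (cinner (P u) v) = - Im (cinner (P v) u)" for u v
    using real[of "u + v"] real[of u] real[of v] by (simp add: add cinner_add_left cinner_add_right)
  have "inner (P x) y = Im (cinner (P (scaleC \<i> x)) y)"
    by (simp add: bounded_clinear_scaleC[OF P] cinner_scaleC_left inner_eq_Re_cinner)
  also have "\<dots> = - Im (cinner (P y) (scaleC \<i> x))" by (rule anti)
  also have "\<dots> = inner (P y) x" by (simp add: cinner_scaleC_right inner_eq_Re_cinner)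
  finally show ?thesis by (simp add: inner_commute)
qed

context
  fixes S :: "'a::complex_hilbert \<Rightarrow> 'a" and c :: real
  assumes S: "bounded_clinear S" and c: "0 < c" and bound: "\<And>x. norm (S x) \<le> c * norm x"
begin

text \<open>Resolves the definite description in \<open>op_abs\<close>: the iteration gives
  existence and \<open>sqrt_op_unique\<close> gives uniqueness. Every admissible \<open>c\<close>
  yields the same operator, so \<open>S\<close> and its adjoint can share one.\<close>

lemma op_abs_eq_sqrt_op:
  "positive_op (sqrt_op (c\<^sup>2) (cadjoint S \<circ> S))" (is "positive_op ?R")
  "op_abs S = sqrt_op (c\<^sup>2) (cadjoint S \<circ> S)"
proof -
  let ?P = "cadjoint S \<circ> S"
  have P: "bounded_clinear ?P" using S by (simp add: bounded_clinear_compose bounded_clinear_cadjoint)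
  have lin: "linear ?P" by (rule bounded_linear.linear[OF bounded_clinear_imp_bounded_linear[OF P]])
  have contr: "norm (v - ?P v /\<^sub>R c\<^sup>2) \<le> norm v" for v
    using adjoint_norm_sq_le[OF inner_cadjoint[OF S] c bound] by simp
  have sym: "inner (?P x) y = inner x (?P y)" for x y
    by (simp add: inner_eq_Re_cinner cinner_cadjoint_left cinner_cadjoint S)
  have c2: "0 < c\<^sup>2" using c by simp
  \<comment> \<open>Commuting with complex scalars is the intertwining property for
    \<open>scaleC\<close>.\<close>
  have R: "bounded_clinear ?R"
    unfolding bounded_clinear_def
    using bounded_linear_sqrt_op[OF lin c2 contr]
      sqrt_op_intertwine[OF bounded_linear_scaleC lin lin contr contr] bounded_clinear_scaleC[OF P]
    by metis
  have R_sym: "inner (?R x) y = inner x (?R y)" for x y by (rule sqrt_op_sym[OF lin c2 contr sym])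
  have "cinner (?R x) y = cinner x (?R y)" for x y
    by (rule cinner_adjointI[OF R R_sym bounded_clinear_scaleC[OF R]])
  \<comment> \<open>Positivity in the complex order includes being real, which follows from
    self-adjointness.\<close>
  then have "cinner (?R x) x = cnj (cinner (?R x) x)" for x by (metis cinner_commute)
  then have "Im (cinner (?R x) x) = 0" for x by (metis Reals_cnj_iff complex_is_Real_iff)
  then show pos: "positive_op ?R"
    using R sqrt_op_pos[OF lin c2 contr]
    by (simp add: positive_op_def less_eq_complex_def inner_eq_Re_cinner comp_def)
  show "op_abs S = ?R"
    unfolding op_abs_def
  proof (rule the_equality)
    show "positive_op ?R \<and> ?R \<circ> ?R = ?P"
      using pos sqrt_op_square[OF lin c2 contr] by (simp add: fun_eq_iff comp_def)
    fix Q assume Q: "positive_op Q \<and> Q \<circ> Q = ?P"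
    show "Q = ?R"
    proof (rule sqrt_op_unique[OF c2 contr sym])
      show "bounded_linear Q"
        using Q by (simp add: positive_op_def bounded_clinear_imp_bounded_linear)
      show "inner (Q x) y = inner x (Q y)" for x y using Q positive_op_sym by blast
      show "0 \<le> inner (Q x) x" for x
        using Q by (simp add: positive_op_def less_eq_complex_def inner_eq_Re_cinner)
      show "Q (Q x) = ?P x" for x using Q by (metis comp_apply)
    qed
  qed
qed

end

lemma positive_op_op_abs: "bounded_clinear S \<Longrightarrow> positive_op (op_abs S)"
  by (metis bounded_clinear_bound op_abs_eq_sqrt_op)

lemma positive_op_inner: "positive_op P \<Longrightarrow> 0 \<le> inner (P x) x"
  by (simp add: positive_op_def less_eq_complex_def inner_eq_Re_cinner)

text \<open>Apply the real version to \<open>x\<close> rotated by the phase that makes the left side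
  real.\<close>

lemma mixed_schwarz:
  assumes S: "bounded_clinear S"
  shows "cmod (cinner (S x) y)
    \<le> sqrt (inner (op_abs S x) x * inner (op_abs (cadjoint S) y) y)"
proof -
  obtain c where c: "0 < c" and bound: "\<And>x. norm (S x) \<le> c * norm x"
    using bounded_clinear_bound[OF S] by blast
  note S' = bounded_clinear_cadjoint[OF S]
  have bound': "norm (cadjoint S x) \<le> c * norm x" for x
    by (rule adjoint_norm_le[OF inner_cadjoint[OF S] bound])
  obtain d where d: "cmod d = 1" "inner (scaleC d (S x)) y = cmod (cinner (S x) y)"
    by (rule cinner_phase)
  have "inner (S (scaleC d x)) y \<le> sqrt (inner (op_abs S (scaleC d x)) (scaleC d x)
      * inner (op_abs (cadjoint S) y) y)"
    using mixed_schwarz_real[OF bounded_clinear_imp_bounded_linear[OF S]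
        bounded_clinear_imp_bounded_linear[OF S'] inner_cadjoint[OF S] c bound]
    by (simp add: op_abs_eq_sqrt_op(2)[OF S c bound] op_abs_eq_sqrt_op(2)[OF S' c bound']
        cadjoint_cadjoint[OF S])
  \<comment> \<open>A unimodular factor does not change the quadratic form.\<close>
  moreover have "inner (op_abs S (scaleC d x)) (scaleC d x) = inner (op_abs S x) x"
  proof -
    have "bounded_clinear (op_abs S)" using positive_op_op_abs[OF S] by (simp add: positive_op_def)
    then have "cinner (op_abs S (scaleC d x)) (scaleC d x) = d * cnj d * cinner (op_abs S x) x"
      by (simp add: bounded_clinear_scaleC cinner_scaleC_left cinner_scaleC_right)
    also have "d * cnj d = 1" using d(1) by (simp flip: complex_norm_square)
    finally show ?thesis by (simp add: inner_eq_Re_cinner)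
  qed
  ultimately show ?thesis using d(2) by (simp add: bounded_clinear_scaleC[OF S])
qed

section \<open>Spectral radius of a sum of products\<close>

lemma onorm_op_abs_add_ge:
  assumes "bounded_clinear S" "bounded_clinear T"
  shows "inner (op_abs S x) x + inner (op_abs T x) x
    \<le> onorm (\<lambda>x. op_abs S x + op_abs T x) * (norm x)\<^sup>2"
proof -
  let ?F = "\<lambda>x. op_abs S x + op_abs T x"
  have "bounded_linear ?F"
    using positive_op_op_abs[OF assms(1)] positive_op_op_abs[OF assms(2)]
    by (simp add: positive_op_def bounded_clinear_def bounded_linear_add)
  then have le: "norm (?F x) \<le> onorm ?F * norm x" by (rule onorm)
  have "inner (op_abs S x) x + inner (op_abs T x) x \<le> norm (?F x) * norm x"
    using norm_cauchy_schwarz[of "?F x" x] by (simp add: inner_add_left)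
  also have "\<dots> \<le> onorm ?F * norm x * norm x" using le by (rule mult_right_mono) simp
  finally show ?thesis by (simp add: power2_eq_square mult.assoc)
qed

lemma sqrt_mult_add_le:
  fixes p q r s :: real
  assumes "0 \<le> p" "0 \<le> q" "0 \<le> r" "0 \<le> s"
  shows "sqrt (p * q) + sqrt (s * r) \<le> sqrt (p + s) * sqrt (q + r)"
proof -
  have "(sqrt p * sqrt q + sqrt s * sqrt r)\<^sup>2 \<le> ((sqrt p)\<^sup>2 + (sqrt s)\<^sup>2) * ((sqrt q)\<^sup>2 + (sqrt r)\<^sup>2)"
  proof -
    \<comment> \<open>Lagrange identity: this square is the difference of the two sides.\<close>
    have "0 \<le> (sqrt p * sqrt r - sqrt s * sqrt q)\<^sup>2" by simp
    then show ?thesis by (simp only: power2_eq_square) (simp only: algebra_simps)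
  qed
  also have "\<dots> = (p + s) * (q + r)" using assms by simp
  finally have "sqrt p * sqrt q + sqrt s * sqrt r \<le> sqrt ((p + s) * (q + r))" by (rule real_le_rsqrt)
  then show ?thesis by (simp add: real_sqrt_mult)
qed

text \<open>The two mixed Schwarz bounds are regrouped by vector: the forms at \<open>x\<close>
  belong to the moduli of \<open>S\<close> and of the adjoint of \<open>T\<close>, those at
  \<open>y\<close> to the moduli of \<open>T\<close> and of the adjoint of \<open>S\<close>. This is
  why the norms of sums appear.\<close>

lemma cinner_pair_le:
  assumes S: "bounded_clinear S" and T: "bounded_clinear T"
  shows "cmod (cinner (S x) y) + cmod (cinner (T y) x)
    \<le> sqrt (onorm (\<lambda>x. op_abs S x + op_abs (cadjoint T) x))
      * sqrt (onorm (\<lambda>x. op_abs T x + op_abs (cadjoint S) x)) * norm x * norm y"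
proof -
  note S' = bounded_clinear_cadjoint[OF S] and T' = bounded_clinear_cadjoint[OF T]
  note pos = positive_op_inner[OF positive_op_op_abs]
  let ?p = "inner (op_abs S x) x" and ?q = "inner (op_abs (cadjoint S) y) y"
  let ?r = "inner (op_abs T y) y" and ?s = "inner (op_abs (cadjoint T) x) x"
  let ?M = "onorm (\<lambda>x. op_abs S x + op_abs (cadjoint T) x)"
  let ?N = "onorm (\<lambda>x. op_abs T x + op_abs (cadjoint S) x)"
  have "cmod (cinner (S x) y) + cmod (cinner (T y) x) \<le> sqrt (?p * ?q) + sqrt (?s * ?r)"
    using mixed_schwarz[OF S, of x y] mixed_schwarz[OF T, of y x] by (simp add: mult.commute)
  also have "\<dots> \<le> sqrt (?p + ?s) * sqrt (?q + ?r)"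
    by (intro sqrt_mult_add_le pos S T S' T')
  also have "\<dots> \<le> sqrt (?M * (norm x)\<^sup>2) * sqrt (?N * (norm y)\<^sup>2)"
  proof (rule mult_mono)
    show "sqrt (?p + ?s) \<le> sqrt (?M * (norm x)\<^sup>2)"
      using onorm_op_abs_add_ge[OF S T'] by simp
    show "sqrt (?q + ?r) \<le> sqrt (?N * (norm y)\<^sup>2)"
      using onorm_op_abs_add_ge[OF T S', of y] by (simp add: add.commute)
    show "0 \<le> sqrt (?q + ?r)" using pos[OF S'] pos[OF T] by simp
    have "0 \<le> ?M * (norm x)\<^sup>2"
      using onorm_op_abs_add_ge[OF S T', of x] pos[OF S, of x] pos[OF T', of x] by linarith
    then show "0 \<le> sqrt (?M * (norm x)\<^sup>2)" by simp
  qed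
  finally show ?thesis by (simp add: real_sqrt_mult mult_ac)
qed

section \<open>Numerical radius\<close>

lemma numerical_radius_bdd:
  assumes "bounded_clinear T"
  shows "bdd_above (insert 0 {cmod (cinner (T x) x) | x. norm x = 1})"
proof -
  obtain c where c: "0 < c" "\<And>x. norm (T x) \<le> c * norm x"
    using bounded_clinear_bound[OF assms] by blast
  have "cmod (cinner (T x) x) \<le> c" if "norm x = 1" for x
    using cmod_cinner_le[of "T x" x] c(2)[of x] that by simp
  then show ?thesis using c(1) by (auto intro!: bdd_aboveI[of _ c])
qed

lemma numerical_radius_nonneg:
  "bounded_clinear T \<Longrightarrow> 0 \<le> numerical_radius T"
  unfolding numerical_radius_def by (intro cSup_upper numerical_radius_bdd) auto

lemma cinner_le_numerical_radius:
  assumes "bounded_clinear T"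
  shows "cmod (cinner (T x) x) \<le> numerical_radius T * (norm x)\<^sup>2"
proof (cases "x = 0")
  case True
  then show ?thesis
    by (simp add: bounded_linear.linear linear_0 bounded_clinear_imp_bounded_linear[OF assms])
next
  case False
  define y where "y = x /\<^sub>R norm x"
  have "norm y = 1" using False by (simp add: y_def)
  then have "cmod (cinner (T y) y) \<le> numerical_radius T"
    unfolding numerical_radius_def by (intro cSup_upper numerical_radius_bdd assms) auto
  moreover have x: "x = scaleC (complex_of_real (norm x)) y"
    using False by (simp add: y_def flip: scaleR_scaleC)
  have "cinner (T x) x = complex_of_real ((norm x)\<^sup>2) * cinner (T y) y"
    by (subst (1 2) x) (simp add: bounded_clinear_scaleC[OF assms] cinner_scaleC_left
        cinner_scaleC_right power2_eq_square)
  then have "cmod (cinner (T x) x) = (norm x)\<^sup>2 * cmod (cinner (T y) y)"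
    by (simp add: norm_mult norm_power)
  ultimately show ?thesis by (simp only: mult.commute[of "(norm x)\<^sup>2"] mult_right_mono zero_le_power2)
qed

section \<open>Invertibility at spectral parameters of modulus above \<open>w\<close>\<close>

text \<open>For \<open>x\<^sub>i = B\<^sub>i x\<close> one has \<open>B\<^sub>i (\<Sum>\<^sub>j A\<^sub>j x\<^sub>j) = z x\<^sub>i + B\<^sub>i y\<close> with
  \<open>y = \<Sum>\<^sub>j A\<^sub>j B\<^sub>j x - z x\<close>: the operator matrix \<open>[B\<^sub>i A\<^sub>j]\<close> replaces \<open>\<Sum>\<^sub>j A\<^sub>j B\<^sub>j\<close>.\<close>

lemma sum_compose_bounded_below:
  fixes A B :: "'i \<Rightarrow> 'h::complex_hilbert \<Rightarrow> 'h"
  assumes "finite I"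
    and A: "\<And>i. i \<in> I \<Longrightarrow> bounded_clinear (A i)"
    and B: "\<And>i. i \<in> I \<Longrightarrow> bounded_clinear (B i)"
    and form: "\<And>x. cmod (\<Sum>i\<in>I. cinner (B i (\<Sum>j\<in>I. A j (x j))) (x i)) \<le> w * (\<Sum>i\<in>I. (norm (x i))\<^sup>2)"
    and "0 \<le> w" "w < cmod z"
  obtains d where "0 < d" "\<And>x. d * norm x \<le> norm ((\<Sum>i\<in>I. A i (B i x)) - scaleC z x)"
proof -
  have "\<exists>c. 0 < c \<and> (\<forall>x. norm (A i x) \<le> c * norm x)" if "i \<in> I" for i
    using bounded_clinear_bound[OF A[OF that]] by blast
  then obtain \<alpha> where \<alpha>: "\<And>i. i \<in> I \<Longrightarrow> 0 < \<alpha> i" "\<And>i x. i \<in> I \<Longrightarrow> norm (A i x) \<le> \<alpha> i * norm x"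
    by metis
  have "\<exists>c. 0 < c \<and> (\<forall>x. norm (B i x) \<le> c * norm x)" if "i \<in> I" for i
    using bounded_clinear_bound[OF B[OF that]] by blast
  then obtain \<beta> where \<beta>: "\<And>i. i \<in> I \<Longrightarrow> 0 < \<beta> i" "\<And>i x. i \<in> I \<Longrightarrow> norm (B i x) \<le> \<beta> i * norm x"
    by metis
  define a where "a = (\<Sum>i\<in>I. \<alpha> i)"
  define b where "b = (\<Sum>i\<in>I. \<beta> i)"
  define e where "e = cmod z - w"
  have a0: "0 \<le> a" unfolding a_def using \<alpha>(1) by (simp add: sum_nonneg less_imp_le)
  have b0: "0 \<le> b" unfolding b_def using \<beta>(1) by (simp add: sum_nonneg less_imp_le)
  have e0: "0 < e" and z0: "0 < cmod z" using assms(5,6) by (auto simp: e_def)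
  \<comment> \<open>Obtained by combining \<open>cmod z * norm x \<le> a * N + norm y\<close> with
    \<open>e * N \<le> b * norm y\<close>, where \<open>y\<close> is the image of \<open>x\<close>
    and \<open>N\<close> the length of the vector of all \<open>B i x\<close>.\<close>
  define C where "C = 1 + a * b / e"
  have C0: "0 < C" using a0 b0 e0 by (simp add: C_def add_pos_nonneg)
  have main: "cmod z * norm x \<le> C * norm ((\<Sum>i\<in>I. A i (B i x)) - scaleC z x)" for x
  proof -
    define y where "y = (\<Sum>i\<in>I. A i (B i x)) - scaleC z x"
    define N where "N = sqrt (\<Sum>i\<in>I. (norm (B i x))\<^sup>2)"
    have N2: "N\<^sup>2 = (\<Sum>i\<in>I. (norm (B i x))\<^sup>2)" by (simp add: N_def sum_nonneg)
    have N0: "0 \<le> N" by (simp add: N_def sum_nonneg)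
    have le_N: "norm (B i x) \<le> N" if "i \<in> I" for i
      unfolding N_def using that \<open>finite I\<close>
      by (intro real_le_rsqrt member_le_sum[of i I "\<lambda>i. (norm (B i x))\<^sup>2"]) auto
    have "B i (\<Sum>j\<in>I. A j (B j x)) = scaleC z (B i x) + B i y" if "i \<in> I" for i
    proof -
      interpret B: bounded_linear "B i" by (rule bounded_clinear_imp_bounded_linear[OF B[OF that]])
      show ?thesis by (simp add: y_def B.diff bounded_clinear_scaleC[OF B[OF that]])
    qed
    then have "(\<Sum>i\<in>I. cinner (B i (\<Sum>j\<in>I. A j (B j x))) (B i x))
        = (\<Sum>i\<in>I. z * complex_of_real ((norm (B i x))\<^sup>2) + cinner (B i y) (B i x))"
      by (intro sum.cong) (simp_all add: cinner_add_left cinner_scaleC_left cinner_self)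
    also have "\<dots> = z * complex_of_real (N\<^sup>2) + (\<Sum>i\<in>I. cinner (B i y) (B i x))"
      unfolding N2 by (simp only: sum.distrib sum_distrib_left of_real_sum)
    finally have "z * complex_of_real (N\<^sup>2) = (\<Sum>i\<in>I. cinner (B i (\<Sum>j\<in>I. A j (B j x))) (B i x))
        - (\<Sum>i\<in>I. cinner (B i y) (B i x))" by simp
    then have "cmod z * N\<^sup>2 \<le> cmod (\<Sum>i\<in>I. cinner (B i (\<Sum>j\<in>I. A j (B j x))) (B i x))
        + cmod (\<Sum>i\<in>I. cinner (B i y) (B i x))"
      by (metis norm_triangle_ineq4 norm_mult norm_of_real abs_of_nonneg zero_le_power2)
    moreover have "cmod (\<Sum>i\<in>I. cinner (B i y) (B i x)) \<le> b * norm y * N"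
    proof -
      have "cmod (\<Sum>i\<in>I. cinner (B i y) (B i x)) \<le> (\<Sum>i\<in>I. \<beta> i * norm y * N)"
      proof (rule sum_norm_le)
        fix i assume i: "i \<in> I"
        have "cmod (cinner (B i y) (B i x)) \<le> norm (B i y) * norm (B i x)" by (rule cmod_cinner_le)
        also have "\<dots> \<le> \<beta> i * norm y * N"
          using \<beta>(1)[OF i] by (intro mult_mono \<beta>(2) le_N i) auto
        finally show "cmod (cinner (B i y) (B i x)) \<le> \<beta> i * norm y * N" .
      qed
      then show ?thesis by (simp add: b_def sum_distrib_right)
    qed
    ultimately have "cmod z * N\<^sup>2 \<le> w * N\<^sup>2 + b * norm y * N"
      using form[of "\<lambda>i. B i x"] by (simp add: N2)
    then have "N * (e * N) \<le> N * (b * norm y)"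
      by (simp add: e_def power2_eq_square algebra_simps)
    \<comment> \<open>One factor \<open>N\<close> cancels; for \<open>N = 0\<close> the left side is
      0.\<close>
    then have eN: "e * N \<le> b * norm y"
      using N0 b0 by (cases "N = 0") (auto simp: mult_le_cancel_left_pos)
    have "scaleC z x = (\<Sum>i\<in>I. A i (B i x)) - y" by (simp add: y_def)
    then have "cmod z * norm x \<le> norm (\<Sum>i\<in>I. A i (B i x)) + norm y"
      by (metis norm_scaleC norm_triangle_ineq4)
    also have "norm (\<Sum>i\<in>I. A i (B i x)) \<le> (\<Sum>i\<in>I. \<alpha> i * N)"
    proof (rule sum_norm_le)
      fix i assume i: "i \<in> I"
      show "norm (A i (B i x)) \<le> \<alpha> i * N"
        by (rule order_trans[OF \<alpha>(2)[OF i] mult_left_mono[OF le_N[OF i] less_imp_le[OF \<alpha>(1)[OF i]]]])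
    qed
    also have "(\<Sum>i\<in>I. \<alpha> i * N) = a * N" by (simp add: a_def sum_distrib_right)
    also have "a * N \<le> a * (b * norm y / e)"
      using eN e0 by (intro mult_left_mono a0) (simp add: field_simps)
    finally show ?thesis by (simp add: C_def algebra_simps flip: y_def)
  qed
  show ?thesis
  proof (rule that)
    show "0 < cmod z / C" using z0 C0 by simp
    show "cmod z / C * norm x \<le> norm ((\<Sum>i\<in>I. A i (B i x)) - scaleC z x)" for x
      using main[of x] C0 by (simp add: field_simps)
  qed
qed

text \<open>If \<open>D\<^sup>*\<close> is bounded below then \<open>D D\<^sup>*\<close> is coercive, so \<open>D\<close> is onto.\<close>

lemma invertible_if_bounded_below:
  assumes D: "bounded_clinear D"
    and d: "0 < d" "\<And>x. d * norm x \<le> norm (D x)"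
    and e: "0 < e" "\<And>x. e * norm x \<le> norm (cadjoint D x)"
  obtains S where "bounded_clinear S" "S \<circ> D = id" "D \<circ> S = id"
proof -
  note D' = bounded_clinear_cadjoint[OF D]
  interpret D: bounded_linear D by (rule bounded_clinear_imp_bounded_linear[OF D])
  have "surj (D \<circ> cadjoint D)"
  proof (rule lax_milgram_surj)
    show "bounded_linear (D \<circ> cadjoint D)"
      by (intro bounded_clinear_imp_bounded_linear bounded_clinear_compose D D')
    show "0 < e\<^sup>2" using e by simp
    show "e\<^sup>2 * (norm x)\<^sup>2 \<le> inner ((D \<circ> cadjoint D) x) x" for x
    proof -
      have "(e * norm x)\<^sup>2 \<le> (norm (cadjoint D x))\<^sup>2" using e by (intro power_mono) auto
      then show ?thesis by (simp add: inner_cadjoint[OF D] power2_norm_eq_inner power_mult_distrib)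
    qed
  qed
  then have "surj D" unfolding surj_def comp_def by blast
  moreover have "inj D"
  proof (rule injI)
    fix x y assume "D x = D y"
    then have "d * norm (x - y) \<le> 0" using d(2)[of "x - y"] by (simp add: D.diff)
    then show "x = y" using d(1) by (simp add: mult_le_0_iff)
  qed
  ultimately have left: "inv_into UNIV D (D x) = x" and right: "D (inv_into UNIV D x) = x" for x
    by (simp_all add: surj_f_inv_f)
  have "bounded_clinear (inv_into UNIV D)"
    unfolding bounded_clinear_def
  proof (intro conjI allI bounded_linear_intro)
    show "inv_into UNIV D (x + y) = inv_into UNIV D x + inv_into UNIV D y" for x y
      by (metis left right D.add)
    show "inv_into UNIV D (r *\<^sub>R x) = r *\<^sub>R inv_into UNIV D x" for r x
      by (metis left right D.scaleR)
    show "inv_into UNIV D (scaleC c x) = scaleC c (inv_into UNIV D x)" for c x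
      by (metis left right bounded_clinear_scaleC[OF D])
    show "norm (inv_into UNIV D x) \<le> norm x * (1 / d)" for x
      using d(1) d(2)[of "inv_into UNIV D x"] by (simp add: right field_simps)
  qed
  then show ?thesis using that[of "inv_into UNIV D"] left right by (simp add: fun_eq_iff)
qed

text \<open>The adjoint of the operator matrix with entries \<open>B i \<circ> A j\<close> has
  entries \<open>cadjoint (A i) \<circ> cadjoint (B j)\<close>. Hence a bound on the form also
  serves the adjoint problem.\<close>

lemma sum_form_cadjoint:
  fixes x :: "'i \<Rightarrow> 'h::complex_hilbert"
  assumes A: "\<And>i. i \<in> I \<Longrightarrow> bounded_clinear (A i)"
    and B: "\<And>i. i \<in> I \<Longrightarrow> bounded_clinear (B i)"
  shows "(\<Sum>i\<in>I. cinner (cadjoint (A i) (\<Sum>j\<in>I. cadjoint (B j) (x j))) (x i))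
    = cnj (\<Sum>i\<in>I. cinner (B i (\<Sum>j\<in>I. A j (x j))) (x i))"
proof -
  have "(\<Sum>i\<in>I. cinner (cadjoint (A i) (\<Sum>j\<in>I. cadjoint (B j) (x j))) (x i))
      = (\<Sum>i\<in>I. \<Sum>j\<in>I. cinner (cadjoint (B j) (x j)) (A i (x i)))"
    by (intro sum.cong refl) (simp add: cinner_cadjoint_left A cinner_sum_left)
  also have "\<dots> = (\<Sum>j\<in>I. \<Sum>i\<in>I. cinner (cadjoint (B j) (x j)) (A i (x i)))" by (rule sum.swap)
  also have "\<dots> = (\<Sum>j\<in>I. cnj (cinner (B j (\<Sum>i\<in>I. A i (x i))) (x j)))"
  proof (intro sum.cong refl)
    fix j assume j: "j \<in> I"
    have "cinner (\<Sum>i\<in>I. A i (x i)) (cadjoint (B j) (x j)) = cinner (B j (\<Sum>i\<in>I. A i (x i))) (x j)"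
      by (simp add: cinner_cadjoint B j)
    then have "cnj (cinner (B j (\<Sum>i\<in>I. A i (x i))) (x j))
        = (\<Sum>i\<in>I. cnj (cinner (A i (x i)) (cadjoint (B j) (x j))))"
      by (simp add: cinner_sum_left flip: cnj_sum)
    then show "(\<Sum>i\<in>I. cinner (cadjoint (B j) (x j)) (A i (x i)))
        = cnj (cinner (B j (\<Sum>i\<in>I. A i (x i))) (x j))"
      by (simp flip: cinner_commute)
  qed
  finally show ?thesis by simp
qed

text \<open>For \<open>w < cmod z\<close> both the shifted sum and its adjoint are bounded below, so
  the shifted sum is invertible and \<open>z\<close> lies outside the spectrum.\<close>

lemma spectral_radius_sum_le:
  fixes A B :: "'i \<Rightarrow> 'h::complex_hilbert \<Rightarrow> 'h"
  assumes "finite I"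
    and A: "\<And>i. i \<in> I \<Longrightarrow> bounded_clinear (A i)"
    and B: "\<And>i. i \<in> I \<Longrightarrow> bounded_clinear (B i)"
    and form: "\<And>x. cmod (\<Sum>i\<in>I. cinner (B i (\<Sum>j\<in>I. A j (x j))) (x i)) \<le> w * (\<Sum>i\<in>I. (norm (x i))\<^sup>2)"
    and "0 \<le> w"
  shows "op_spectral_radius (\<lambda>x. \<Sum>i\<in>I. A i (B i x)) \<le> w"
proof -
  let ?C = "\<lambda>x. \<Sum>i\<in>I. A i (B i x)"
  have C: "bounded_clinear ?C"
    using bounded_clinear_sum[of I "\<lambda>i. A i \<circ> B i"] by (simp add: bounded_clinear_compose A B)
  have "cmod z \<le> w" if z: "z \<in> op_spectrum ?C" for z
  proof (rule ccontr)
    assume "\<not> cmod z \<le> w"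
    then have w: "w < cmod z" by simp
    let ?D = "\<lambda>x. ?C x - scaleC z x"
    have D: "bounded_clinear ?D" by (rule bounded_clinear_diff_scaleC[OF C])
    let ?D' = "\<lambda>x. (\<Sum>i\<in>I. cadjoint (B i) (cadjoint (A i) x)) - scaleC (cnj z) x"
    have A': "bounded_clinear (cadjoint (A i))" and B': "bounded_clinear (cadjoint (B i))"
      if "i \<in> I" for i using that by (simp_all add: bounded_clinear_cadjoint A B)
    have "bounded_clinear (\<lambda>x. \<Sum>i\<in>I. cadjoint (B i) (cadjoint (A i) x))"
      using bounded_clinear_sum[of I "\<lambda>i. cadjoint (B i) \<circ> cadjoint (A i)"]
      by (simp add: bounded_clinear_compose A' B')
    then have D': "bounded_clinear ?D'" by (rule bounded_clinear_diff_scaleC)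
    have adj: "cadjoint ?D = ?D'"
    proof (rule cadjointI[OF D'])
      fix x y
      have "cinner (?C x) y = cnj (cinner (\<Sum>i\<in>I. cadjoint (B i) (cadjoint (A i) y)) x)"
        by (simp add: cinner_sum_left cinner_cadjoint cinner_cadjoint_left A B A' B'
            flip: cinner_commute cong: sum.cong)
      then have "cinner (?C x) y = cinner x (\<Sum>i\<in>I. cadjoint (B i) (cadjoint (A i) y))"
        by (simp flip: cinner_commute)
      moreover have "cinner x (u - v) = cinner x u - cinner x v" for u v
        using cinner_add_right[of x "u - v" v] by simp
      ultimately show "cinner (?D x) y = cinner x (?D' y)"
        by (simp add: cinner_diff_left cinner_scaleC_left cinner_scaleC_right)
    qed
    obtain d where d: "0 < d" "\<And>x. d * norm x \<le> norm (?D x)"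
      using sum_compose_bounded_below[OF \<open>finite I\<close> A B form \<open>0 \<le> w\<close> w] by blast
    have form': "cmod (\<Sum>i\<in>I. cinner (cadjoint (A i) (\<Sum>j\<in>I. cadjoint (B j) (x j))) (x i))
        \<le> w * (\<Sum>i\<in>I. (norm (x i))\<^sup>2)" for x
      using form[of x] by (simp only: sum_form_cadjoint[OF A B] complex_mod_cnj)
    \<comment> \<open>The same lower bound with the families exchanged: the adjoints of
      \<open>B\<close> on the outside, those of \<open>A\<close> on the inside, and the conjugate
      parameter.\<close>
    obtain e where e: "0 < e" "\<And>x. e * norm x \<le> norm (?D' x)"
      using sum_compose_bounded_below[OF \<open>finite I\<close> B' A' form' \<open>0 \<le> w\<close>, of "cnj z"] w
      by auto
    obtain S where "bounded_clinear S" "S \<circ> ?D = id" "?D \<circ> S = id"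
      by (rule invertible_if_bounded_below[OF D d e(1)]) (auto simp: adj e(2))
    then show False using z by (auto simp: op_spectrum_def)
  qed
  \<comment> \<open>The supremum also ranges over the inserted value 0, which
    \<open>0 \<le> w\<close> covers.\<close>
  then show ?thesis unfolding op_spectral_radius_def using \<open>0 \<le> w\<close>
    by (intro cSup_least) auto
qed

section \<open>Upper triangular matrices\<close>

lemma sum_above_diagonal_swap:
  fixes g :: "nat \<Rightarrow> nat \<Rightarrow> 'a::comm_monoid_add"
  shows "(\<Sum>i=1..n. \<Sum>j=i+1..n. g i j) = (\<Sum>i=1..n. \<Sum>j=1..i-1. g j i)"
proof -
  have "(\<Sum>i=1..n. \<Sum>j=i+1..n. g i j) = (\<Sum>i=1..n. \<Sum>j | j \<in> {1..n} \<and> i < j. g i j)"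
    by (intro sum.cong) auto
  also have "\<dots> = (\<Sum>j=1..n. \<Sum>i | i \<in> {1..n} \<and> i < j. g i j)"
    by (rule sum.swap_restrict) auto
  also have "\<dots> = (\<Sum>i=1..n. \<Sum>j=1..i-1. g j i)"
    by (intro sum.cong) auto
  finally show ?thesis .
qed

text \<open>Positions \<open>(i, j)\<close> and \<open>(j, i)\<close> are kept together because the
  coefficient \<open>a i j\<close> bounds only their joint contribution.\<close>

lemma sum_square_split:
  fixes f :: "nat \<Rightarrow> nat \<Rightarrow> 'a::comm_monoid_add"
  shows "(\<Sum>i=1..n. \<Sum>j=1..n. f i j)
    = (\<Sum>i=1..n. f i i) + (\<Sum>i=1..n. \<Sum>j=i+1..n. f i j + f j i)"
proof -
  have "(\<Sum>j=1..n. f i j) = f i i + ((\<Sum>j=i+1..n. f i j) + (\<Sum>j=1..i-1. f i j))"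
    if "i \<in> {1..n}" for i
  proof -
    have "{1..n} = insert i ({i+1..n} \<union> {1..i-1})" using that by auto
    then have "(\<Sum>j=1..n. f i j) = (\<Sum>j\<in>insert i ({i+1..n} \<union> {1..i-1}). f i j)" by (rule arg_cong)
    also have "\<dots> = f i i + (\<Sum>j\<in>{i+1..n} \<union> {1..i-1}. f i j)"
      using that by (subst sum.insert) auto
    also have "(\<Sum>j\<in>{i+1..n} \<union> {1..i-1}. f i j) = (\<Sum>j=i+1..n. f i j) + (\<Sum>j=1..i-1. f i j)"
      by (rule sum.union_disjoint) auto
    finally show ?thesis .
  qed
  then have "(\<Sum>i=1..n. \<Sum>j=1..n. f i j)
      = (\<Sum>i=1..n. f i i + ((\<Sum>j=i+1..n. f i j) + (\<Sum>j=1..i-1. f i j)))"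
    by (intro sum.cong) auto
  also have "\<dots> = (\<Sum>i=1..n. f i i) + ((\<Sum>i=1..n. \<Sum>j=i+1..n. f i j) + (\<Sum>i=1..n. \<Sum>j=1..i-1. f i j))"
    by (simp only: sum.distrib)
  also have "(\<Sum>i=1..n. \<Sum>j=1..i-1. f i j) = (\<Sum>i=1..n. \<Sum>j=i+1..n. f j i)"
    by (rule sum_above_diagonal_swap[symmetric])
  finally show ?thesis by (simp only: sum.distrib)
qed

text \<open>The body repeats the matrix of the final theorem, so unfolding it there gives exactly
  the claimed inequalities.\<close>

definition upper_mat :: "nat \<Rightarrow> (nat \<Rightarrow> real) \<Rightarrow> (nat \<Rightarrow> nat \<Rightarrow> real) \<Rightarrow> complex mat" where
  "upper_mat n w a = Matrix.mat n n (\<lambda>(k, l).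
    let i = k + 1; j = l + 1 in
    if i = j then complex_of_real (w i)
    else if i < j then complex_of_real (a i j)
    else 0)"

text \<open>The quadratic form of \<open>upper_mat n w a\<close> at a real vector \<open>t\<close>,
  indexed from 1.\<close>

definition upper_form :: "nat \<Rightarrow> (nat \<Rightarrow> real) \<Rightarrow> (nat \<Rightarrow> nat \<Rightarrow> real) \<Rightarrow> (nat \<Rightarrow> real) \<Rightarrow> real" where
  "upper_form n w a t = (\<Sum>i=1..n. w i * (t i)\<^sup>2) + (\<Sum>i=1..n. \<Sum>j=i+1..n. a i j * (t i * t j))"

lemma upper_form_scale: "upper_form n w a (\<lambda>i. c * t i) = c\<^sup>2 * upper_form n w a t"
  by (simp add: upper_form_def sum_distrib_left power_mult_distrib distrib_left power2_eq_square mult_ac)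

lemma upper_form_le_Max:
  assumes "1 \<le> n" and a: "\<And>i j. 1 \<le> i \<Longrightarrow> i < j \<Longrightarrow> j \<le> n \<Longrightarrow> 0 \<le> a i j"
  shows "upper_form n w a t
    \<le> (MAX i\<in>{1..n}. w i + 1/2 * (\<Sum>j=i+1..n. a i j) + 1/2 * (\<Sum>j=1..i-1. a j i)) * (\<Sum>i=1..n. (t i)\<^sup>2)"
proof -
  let ?r = "\<lambda>i. w i + 1/2 * (\<Sum>j=i+1..n. a i j) + 1/2 * (\<Sum>j=1..i-1. a j i)"
  have "a i j * (t i * t j) \<le> 1/2 * (a i j * (t i)\<^sup>2) + 1/2 * (a i j * (t j)\<^sup>2)"
    if "i \<in> {1..n}" "j \<in> {i+1..n}" for i j
  proof -
    have "0 \<le> a i j * (t i - t j)\<^sup>2" using a[of i j] that by simp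
    then show ?thesis by (simp add: power2_eq_square algebra_simps)
  qed
  then have "(\<Sum>i=1..n. \<Sum>j=i+1..n. a i j * (t i * t j))
      \<le> (\<Sum>i=1..n. \<Sum>j=i+1..n. 1/2 * (a i j * (t i)\<^sup>2) + 1/2 * (a i j * (t j)\<^sup>2))"
    by (intro sum_mono) blast
  also have "\<dots> = (\<Sum>i=1..n. \<Sum>j=i+1..n. 1/2 * (a i j * (t i)\<^sup>2))
      + (\<Sum>i=1..n. \<Sum>j=i+1..n. 1/2 * (a i j * (t j)\<^sup>2))"
    by (simp only: sum.distrib)
  \<comment> \<open>Exchanging the sums charges the \<open>(t j)^2\<close> half of each pair to row
    \<open>j\<close>, where it becomes a column sum.\<close>
  also have "(\<Sum>i=1..n. \<Sum>j=i+1..n. 1/2 * (a i j * (t j)\<^sup>2))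
      = (\<Sum>i=1..n. \<Sum>j=1..i-1. 1/2 * (a j i * (t i)\<^sup>2))"
    by (rule sum_above_diagonal_swap)
  finally have "upper_form n w a t \<le> (\<Sum>i=1..n. w i * (t i)\<^sup>2)
      + ((\<Sum>i=1..n. \<Sum>j=i+1..n. 1/2 * (a i j * (t i)\<^sup>2)) + (\<Sum>i=1..n. \<Sum>j=1..i-1. 1/2 * (a j i * (t i)\<^sup>2)))"
    unfolding upper_form_def by (rule add_left_mono)
  also have "\<dots> = (\<Sum>i=1..n. ?r i * (t i)\<^sup>2)"
    by (simp only: distrib_right sum_distrib_right sum_distrib_left sum.distrib mult.assoc add.assoc)
  also have "\<dots> \<le> (\<Sum>i=1..n. (MAX i\<in>{1..n}. ?r i) * (t i)\<^sup>2)"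
    by (intro sum_mono mult_right_mono Max_ge) auto
  finally show ?thesis by (simp only: sum_distrib_left)
qed

lemma cscalar_prod_shift:
  assumes "x \<in> carrier_vec n" "y \<in> carrier_vec n"
  shows "y \<bullet>c x = (\<Sum>i=1..n. y $ (i - 1) * cnj (x $ (i - 1)))"
proof -
  have "y \<bullet>c x = (\<Sum>k<n. y $ k * cnj (x $ k))"
    using assms by (auto simp: scalar_prod_def lessThan_atLeast0 intro!: sum.cong)
  then show ?thesis by (simp add: sum.atLeast1_atMost_eq)
qed

lemma upper_mat_cscalar_prod:
  assumes x: "x \<in> carrier_vec n"
  shows "(upper_mat n w a *\<^sub>v x) \<bullet>c x
    = (\<Sum>i=1..n. w i * (cmod (x $ (i - 1)))\<^sup>2)
      + (\<Sum>i=1..n. \<Sum>j=i+1..n. a i j * (x $ (j - 1) * cnj (x $ (i - 1))))"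
proof -
  let ?y = "\<lambda>i. x $ (i - 1)"
  let ?m = "\<lambda>i j. if i = j then complex_of_real (w i) else if i < j then complex_of_real (a i j) else 0"
  have M: "upper_mat n w a *\<^sub>v x \<in> carrier_vec n" unfolding upper_mat_def by (rule mult_mat_vec_carrier[OF mat_carrier x])
  have "(upper_mat n w a *\<^sub>v x) $ (i - 1) = (\<Sum>j=1..n. ?m i j * ?y j)" if "i \<in> {1..n}" for i
  proof -
    obtain k where k: "i = Suc k" "k < n" using \<open>i \<in> {1..n}\<close> by (cases i) auto
    have "(upper_mat n w a *\<^sub>v x) $ k = (\<Sum>l<n. ?m (Suc k) (Suc l) * x $ l)"
      using x k by (auto simp: upper_mat_def scalar_prod_def lessThan_atLeast0 intro!: sum.cong)
    then show ?thesis unfolding k(1) by (simp add: sum.atLeast1_atMost_eq)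
  qed
  then have "(upper_mat n w a *\<^sub>v x) \<bullet>c x = (\<Sum>i=1..n. \<Sum>j=1..n. ?m i j * ?y j * cnj (?y i))"
    unfolding cscalar_prod_shift[OF x M] by (intro sum.cong) (simp_all add: sum_distrib_right)
  also have "\<dots> = (\<Sum>i=1..n. ?m i i * ?y i * cnj (?y i))
      + (\<Sum>i=1..n. \<Sum>j=i+1..n. ?m i j * ?y j * cnj (?y i) + ?m j i * ?y i * cnj (?y j))"
    by (rule sum_square_split)
  also have "(\<Sum>i=1..n. ?m i i * ?y i * cnj (?y i)) = (\<Sum>i=1..n. w i * (cmod (?y i))\<^sup>2)"
    unfolding of_real_sum by (intro sum.cong) (simp_all add: complex_norm_square mult.assoc del: of_real_power)
  also have "(\<Sum>i=1..n. \<Sum>j=i+1..n. ?m i j * ?y j * cnj (?y i) + ?m j i * ?y i * cnj (?y j))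
      = (\<Sum>i=1..n. \<Sum>j=i+1..n. a i j * (?y j * cnj (?y i)))"
    by (intro sum.cong) (auto simp: mult.assoc)
  finally show ?thesis .
qed

section \<open>Numerical radius of a nonnegative triangular matrix\<close>

context
  fixes n :: nat and w :: "nat \<Rightarrow> real" and a :: "nat \<Rightarrow> nat \<Rightarrow> real"
  assumes n: "1 \<le> n"
    and w: "\<And>i. i \<in> {1..n} \<Longrightarrow> 0 \<le> w i"
    and a: "\<And>i j. 1 \<le> i \<Longrightarrow> i < j \<Longrightarrow> j \<le> n \<Longrightarrow> 0 \<le> a i j"
begin

private abbreviation (input) "unit_values \<equiv>
  {cmod ((upper_mat n w a *\<^sub>v x) \<bullet>c x) | x. x \<in> carrier_vec n \<and> x \<bullet>c x = 1}"

private lemma mat_numerical_radius_upper_mat: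
  "mat_numerical_radius (upper_mat n w a) = Sup unit_values"
  by (simp add: mat_numerical_radius_def upper_mat_def)

private lemma cscalar_prod_self:
  assumes "x \<in> carrier_vec n"
  shows "x \<bullet>c x = complex_of_real (\<Sum>i=1..n. (cmod (x $ (i - 1)))\<^sup>2)"
  unfolding cscalar_prod_shift[OF assms assms] of_real_sum complex_norm_square ..

text \<open>As all entries are nonnegative, the triangle inequality passes to the moduli of the
  coordinates. The bound also shows that the supremum is over a bounded set.\<close>

private lemma unit_values_le:
  assumes "v \<in> unit_values"
  shows "v \<le> (MAX i\<in>{1..n}. w i + 1/2 * (\<Sum>j=i+1..n. a i j) + 1/2 * (\<Sum>j=1..i-1. a j i))"
proof -
  obtain x where x: "x \<in> carrier_vec n" "x \<bullet>c x = 1" and v: "v = cmod ((upper_mat n w a *\<^sub>v x) \<bullet>c x)"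
    using assms by blast
  have unit: "(\<Sum>i=1..n. (cmod (x $ (i - 1)))\<^sup>2) = 1"
    using x(2) unfolding cscalar_prod_self[OF x(1)] of_real_eq_1_iff .
  have "v \<le> upper_form n w a (\<lambda>i. cmod (x $ (i - 1)))"
    unfolding v upper_mat_cscalar_prod[OF x(1)] upper_form_def
  proof (intro order_trans[OF norm_triangle_ineq] add_mono)
    show "cmod (complex_of_real (\<Sum>i=1..n. w i * (cmod (x $ (i - 1)))\<^sup>2)) \<le> (\<Sum>i=1..n. w i * (cmod (x $ (i - 1)))\<^sup>2)"
      unfolding norm_of_real using w by (subst abs_of_nonneg) (auto intro!: sum_nonneg)
    show "cmod (\<Sum>i=1..n. \<Sum>j=i+1..n. a i j * (x $ (j - 1) * cnj (x $ (i - 1))))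
        \<le> (\<Sum>i=1..n. \<Sum>j=i+1..n. a i j * (cmod (x $ (i - 1)) * cmod (x $ (j - 1))))"
    proof (intro sum_norm_le)
      fix i j assume "i \<in> {1..n}" "j \<in> {i+1..n}"
      then show "cmod (a i j * (x $ (j - 1) * cnj (x $ (i - 1)))) \<le> a i j * (cmod (x $ (i - 1)) * cmod (x $ (j - 1)))"
        using a[of i j] by (simp add: norm_mult)
    qed
  qed
  also have "\<dots> \<le> (MAX i\<in>{1..n}. w i + 1/2 * (\<Sum>j=i+1..n. a i j) + 1/2 * (\<Sum>j=1..i-1. a j i))
      * (\<Sum>i=1..n. (cmod (x $ (i - 1)))\<^sup>2)"
    by (rule upper_form_le_Max[OF n a])
  finally show ?thesis by (simp only: unit mult_1_right)
qed

private lemma unit_values_bdd: "bdd_above unit_values"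
  using unit_values_le by (rule bdd_aboveI)

text \<open>Viewed as a complex vector, \<open>t\<close> is one of the competitors in the supremum,
  and its value there is the modulus of the real form.\<close>

private lemma upper_form_unit_le:
  assumes "(\<Sum>i=1..n. (t i)\<^sup>2) = 1"
  shows "\<bar>upper_form n w a t\<bar> \<le> mat_numerical_radius (upper_mat n w a)"
proof -
  define x where "x = vec n (\<lambda>k. complex_of_real (t (k + 1)))"
  have x: "x \<in> carrier_vec n" by (simp add: x_def)
  have xi: "x $ (i - 1) = complex_of_real (t i)" if "i \<in> {1..n}" for i
    using that by (auto simp: x_def)
  have "(\<Sum>i=1..n. (cmod (x $ (i - 1)))\<^sup>2) = 1"
    unfolding assms[symmetric] by (intro sum.cong) (simp_all add: xi del: One_nat_def)
  then have unit: "x \<bullet>c x = 1" by (simp only: cscalar_prod_self[OF x] of_real_1)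
  have "(\<Sum>i=1..n. w i * (cmod (x $ (i - 1)))\<^sup>2) = (\<Sum>i=1..n. w i * (t i)\<^sup>2)"
    by (intro sum.cong) (simp_all add: xi del: One_nat_def)
  moreover have "(\<Sum>i=1..n. \<Sum>j=i+1..n. a i j * (x $ (j - 1) * cnj (x $ (i - 1))))
      = complex_of_real (\<Sum>i=1..n. \<Sum>j=i+1..n. a i j * (t i * t j))"
    unfolding of_real_sum by (intro sum.cong) (auto simp: xi simp del: One_nat_def)
  ultimately have "(upper_mat n w a *\<^sub>v x) \<bullet>c x = complex_of_real (upper_form n w a t)"
    unfolding upper_mat_cscalar_prod[OF x] upper_form_def by simp
  then have "\<bar>upper_form n w a t\<bar> = cmod ((upper_mat n w a *\<^sub>v x) \<bullet>c x)" by (simp only: norm_of_real)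
  then have "\<bar>upper_form n w a t\<bar> \<in> unit_values" using x unit by blast
  then show ?thesis
    unfolding mat_numerical_radius_upper_mat using unit_values_bdd by (rule cSup_upper)
qed

text \<open>The first basis vector, present because \<open>n\<close> is positive. It witnesses
  nonnegativity of the radius and nonemptiness of the set of values.\<close>

private lemma unit_exists: "(\<Sum>i=1..n. (if i = 1 then 1 else 0 :: real)\<^sup>2) = 1"
proof -
  have "(\<Sum>i=1..n. (if i = 1 then 1 else 0 :: real)\<^sup>2) = (\<Sum>i=1..n. if 1 = i then 1 else 0)"
    by (intro sum.cong) auto
  also have "\<dots> = 1" using n by (subst sum.delta') auto
  finally show ?thesis .
qed

lemma mat_numerical_radius_upper_mat_nonneg: "0 \<le> mat_numerical_radius (upper_mat n w a)"
  using upper_form_unit_le[OF unit_exists] by linarith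

lemma upper_form_le_mat_numerical_radius:
  "upper_form n w a t \<le> mat_numerical_radius (upper_mat n w a) * (\<Sum>i=1..n. (t i)\<^sup>2)"
proof (cases "(\<Sum>i=1..n. (t i)\<^sup>2) = 0")
  case True
  then have "t i = 0" if "i \<in> {1..n}" for i
    using that by (subst (asm) sum_nonneg_eq_0_iff) auto
  then have "upper_form n w a t = 0" by (simp add: upper_form_def)
  then show ?thesis using True by simp
next
  case False
  \<comment> \<open>Normalise by the Euclidean length; the form is homogeneous of degree
    two.\<close>
  define s where "s = sqrt (\<Sum>i=1..n. (t i)\<^sup>2)"
  have s2: "s\<^sup>2 = (\<Sum>i=1..n. (t i)\<^sup>2)" by (simp add: s_def sum_nonneg)
  then have s0: "s \<noteq> 0" using False by auto
  have "(\<Sum>i=1..n. (inverse s * t i)\<^sup>2) = (inverse s)\<^sup>2 * s\<^sup>2"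
    unfolding s2 by (simp only: power_mult_distrib sum_distrib_left)
  also have "\<dots> = 1" using s0 by (simp add: field_simps)
  finally have "(inverse s)\<^sup>2 * upper_form n w a t \<le> mat_numerical_radius (upper_mat n w a)"
    using upper_form_unit_le[of "\<lambda>i. inverse s * t i"] by (simp add: upper_form_scale)
  then have "s\<^sup>2 * ((inverse s)\<^sup>2 * upper_form n w a t) \<le> s\<^sup>2 * mat_numerical_radius (upper_mat n w a)"
    by (rule mult_left_mono) simp
  moreover have "s\<^sup>2 * ((inverse s)\<^sup>2 * upper_form n w a t) = upper_form n w a t"
    using s0 by (simp add: field_simps)
  ultimately show ?thesis by (simp only: s2 mult.commute)
qed

lemma mat_numerical_radius_upper_mat_le:
  "mat_numerical_radius (upper_mat n w a)
    \<le> (MAX i\<in>{1..n}. w i + 1/2 * (\<Sum>j=i+1..n. a i j) + 1/2 * (\<Sum>j=1..i-1. a j i))"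
  unfolding mat_numerical_radius_upper_mat
proof (rule cSup_least)
  define x where "x = vec n (\<lambda>k. if k = 0 then 1 else 0 :: complex)"
  have x: "x \<in> carrier_vec n" by (simp add: x_def)
  have "(\<Sum>i=1..n. (cmod (x $ (i - 1)))\<^sup>2) = (\<Sum>i=1..n. (if i = 1 then 1 else 0 :: real)\<^sup>2)"
    by (intro sum.cong) (auto simp: x_def)
  then have "x \<bullet>c x = 1" by (simp only: cscalar_prod_self[OF x] unit_exists of_real_1)
  then show "unit_values \<noteq> {}" using x by blast
qed (rule unit_values_le)

end

section \<open>The form of the operator matrix and the conclusion\<close>

lemma cmod_sum_cinner_le_upper_form:
  fixes A B :: "nat \<Rightarrow> 'h::complex_hilbert \<Rightarrow> 'h"
  assumes A: "\<And>i. i \<in> {1..n} \<Longrightarrow> bounded_clinear (A i)"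
    and B: "\<And>i. i \<in> {1..n} \<Longrightarrow> bounded_clinear (B i)"
    and a: "\<And>i j. 1 \<le> i \<Longrightarrow> i < j \<Longrightarrow> j \<le> n \<Longrightarrow>
      a i j =
        sqrt (onorm (\<lambda>x. op_abs (B i \<circ> A j) x + op_abs (cadjoint (A i) \<circ> cadjoint (B j)) x)) *
        sqrt (onorm (\<lambda>x. op_abs (B j \<circ> A i) x + op_abs (cadjoint (A j) \<circ> cadjoint (B i)) x))"
  shows "cmod (\<Sum>i=1..n. cinner (B i (\<Sum>j=1..n. A j (x j))) (x i))
    \<le> upper_form n (\<lambda>i. numerical_radius (B i \<circ> A i)) a (\<lambda>i. norm (x i))"
proof -
  let ?f = "\<lambda>i j. cmod (cinner (B i (A j (x j))) (x i))"
  have "cinner (B i (\<Sum>j=1..n. A j (x j))) (x i) = (\<Sum>j=1..n. cinner (B i (A j (x j))) (x i))"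
    if "i \<in> {1..n}" for i
    by (simp only: cinner_sum_left
        linear_sum[OF bounded_linear.linear[OF bounded_clinear_imp_bounded_linear[OF B[OF that]]]])
  then have "cmod (\<Sum>i=1..n. cinner (B i (\<Sum>j=1..n. A j (x j))) (x i))
      = cmod (\<Sum>i=1..n. \<Sum>j=1..n. cinner (B i (A j (x j))) (x i))"
    by (intro arg_cong[where f = cmod] sum.cong) auto
  also have "\<dots> \<le> (\<Sum>i=1..n. \<Sum>j=1..n. ?f i j)"
    by (intro sum_norm_le order_refl)
  also have "\<dots> = (\<Sum>i=1..n. ?f i i) + (\<Sum>i=1..n. \<Sum>j=i+1..n. ?f i j + ?f j i)"
    by (rule sum_square_split)
  also have "\<dots> \<le> upper_form n (\<lambda>i. numerical_radius (B i \<circ> A i)) a (\<lambda>i. norm (x i))"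
    unfolding upper_form_def
  proof (intro add_mono sum_mono)
    fix i assume "i \<in> {1..n}"
    then show "?f i i \<le> numerical_radius (B i \<circ> A i) * (norm (x i))\<^sup>2"
      using cinner_le_numerical_radius[of "B i \<circ> A i" "x i"]
      by (simp add: bounded_clinear_compose A B)
  next
    fix i j assume i: "i \<in> {1..n}" and "j \<in> {i+1..n}"
    then have j: "j \<in> {1..n}" "i < j" by auto
    \<comment> \<open>\<open>x j\<close> is the argument of \<open>B i \<circ> A j\<close> and
      \<open>x i\<close> that of \<open>B j \<circ> A i\<close>; \<open>cadjoint_compose\<close>
      produces the products of adjoints that occur in \<open>a i j\<close>.\<close>
    have "?f i j + ?f j i \<le> a i j * norm (x j) * norm (x i)"
      using cinner_pair_le[of "B i \<circ> A j" "B j \<circ> A i" "x j" "x i"] i j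
      by (simp add: bounded_clinear_compose A B cadjoint_compose a comp_apply)
    then show "?f i j + ?f j i \<le> a i j * (norm (x i) * norm (x j))" by (simp add: mult_ac)
  qed
  finally show ?thesis .
qed

theorem theorem2p12:
  fixes n :: nat
    and A B :: "nat \<Rightarrow> 'h::complex_hilbert \<Rightarrow> 'h"
    and a :: "nat \<Rightarrow> nat \<Rightarrow> real"
  assumes "n \<ge> 1"
    and "\<And>i. i \<in> {1..n} \<Longrightarrow> bounded_clinear (A i)"
    and "\<And>i. i \<in> {1..n} \<Longrightarrow> bounded_clinear (B i)"
    and "\<And>i j. 1 \<le> i \<Longrightarrow> i < j \<Longrightarrow> j \<le> n \<Longrightarrow>
      a i j =
        sqrt (onorm (\<lambda>x. op_abs (B i \<circ> A j) x + op_abs (cadjoint (A i) \<circ> cadjoint (B j)) x)) *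
        sqrt (onorm (\<lambda>x. op_abs (B j \<circ> A i) x + op_abs (cadjoint (A j) \<circ> cadjoint (B i)) x))"
  shows "op_spectral_radius (\<lambda>x. \<Sum>i=1..n. A i (B i x))
      \<le> mat_numerical_radius
          (Matrix.mat n n (\<lambda>(k, l).
            \<comment> \<open>rows and columns of \<open>Matrix.mat\<close> are numbered from 0\<close>
            let i = k + 1; j = l + 1 in
            if i = j then complex_of_real (numerical_radius (B i \<circ> A i))
            else if i < j then complex_of_real (a i j)
            else 0))
    \<and> mat_numerical_radius
          (Matrix.mat n n (\<lambda>(k, l).
            let i = k + 1; j = l + 1 in
            if i = j then complex_of_real (numerical_radius (B i \<circ> A i))
            else if i < j then complex_of_real (a i j)
            else 0))
      \<le> (MAX i\<in>{1..n}. numerical_radius (B i \<circ> A i)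
            + 1/2 * (\<Sum>j=i+1..n. a i j) + 1/2 * (\<Sum>j=1..i-1. a j i))"
proof -
  let ?w = "\<lambda>i. numerical_radius (B i \<circ> A i)"
  have w: "0 \<le> ?w i" if "i \<in> {1..n}" for i
    using that by (intro numerical_radius_nonneg bounded_clinear_compose assms(2,3))
  have a: "0 \<le> a i j" if "1 \<le> i" "i < j" "j \<le> n" for i j
  proof -
    \<comment> \<open>Since \<open>sqrt\<close> is odd on the reals, the sign of
      \<open>a i j\<close> is settled only after the operator norms are known to be
      nonnegative.\<close>
    have "0 \<le> onorm (\<lambda>x. op_abs S x + op_abs T x)" if "bounded_clinear S" "bounded_clinear T"
      for S T :: "'h \<Rightarrow> 'h"
      using positive_op_op_abs[OF that(1)] positive_op_op_abs[OF that(2)]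
      by (intro onorm_pos_le) (simp add: positive_op_def bounded_clinear_def bounded_linear_add)
    then show ?thesis
      unfolding assms(4)[OF that] using that
      by (intro mult_nonneg_nonneg real_sqrt_ge_zero) (simp_all add: assms(2,3) bounded_clinear_compose bounded_clinear_cadjoint)
  qed
  have "op_spectral_radius (\<lambda>x. \<Sum>i=1..n. A i (B i x)) \<le> mat_numerical_radius (upper_mat n ?w a)"
  proof (rule spectral_radius_sum_le[where A = A and B = B])
    show "cmod (\<Sum>i=1..n. cinner (B i (\<Sum>j=1..n. A j (x j))) (x i))
        \<le> mat_numerical_radius (upper_mat n ?w a) * (\<Sum>i=1..n. (norm (x i))\<^sup>2)" for x
      by (rule order_trans[OF cmod_sum_cinner_le_upper_form[OF assms(2-4)]
            upper_form_le_mat_numerical_radius[OF assms(1) w a]])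
    show "0 \<le> mat_numerical_radius (upper_mat n ?w a)"
      by (rule mat_numerical_radius_upper_mat_nonneg[OF assms(1) w a])
  qed (simp_all add: assms(2,3))
  moreover have "mat_numerical_radius (upper_mat n ?w a)
      \<le> (MAX i\<in>{1..n}. ?w i + 1/2 * (\<Sum>j=i+1..n. a i j) + 1/2 * (\<Sum>j=1..i-1. a j i))"
    by (rule mat_numerical_radius_upper_mat_le[OF assms(1) w a])
  ultimately show ?thesis unfolding upper_mat_def by (rule conjI)
qed

end
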